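(* The three loop framed isotopy map $\Phi^{fr}:\mathbb{Z}[\mathscr{K}^{fr}]\to A$ is an invariant of framed virtual knots; i.e. the element $\Phi^{fr}(K)\in A$ computed from a virtual knot diagram $K$ depends only on the class of $K$ in $\mathscr{K}^{fr}$.
   Context: A virtual knot diagram is an oriented immersed circle in $\mathbb{R}^2$ with finitely many transverse double points, each marked as a classical crossing (with over/under information) or as a virtual crossing. $\mathscr{K}^{fr}$ denotes the set of framed virtual knots: virtual knot diagrams modulo all extended Reidemeister moves (classical, virtual and mixed) except the classical Reidemeister 1 move. $\mathbb{Z}[\mathscr{K}^{fr}]$ is the free abelian group on this set; maps on $\mathscr{K}^{fr}$ are extended to homomorphisms. The Gauss diagram of a diagram is a counterclockwise oriented circle with, for each classical crossing, a chord joining its two preimages, directed from over to under (an "arrow") and decorated with the sign of the crossing. Crossings and arrows are identified. Two arrows intersect if their chords cross in the disk. Weight of a crossing $c$: $w(c)=\sum_{x\in N_c} sign(x)\,int_c(x)$, where $N_c$ is the set of arrows intersecting $c$, and $int_c(x)=+1$ if, with $c$ drawn pointing upward, $x$ crosses $c$ from left to right, and $-1$ otherwise. $A$ is the group generated by symbols $A_{ij}$, $i,j\in\mathbb{Z}$, with relations $A_{ii}=1$, $A_{ij}^2=1$, $A_{ij}A_{lm}=A_{lm}A_{ij}$, $A_{ij}A_{jk}=A_{ik}$ for all indices. $\mathcal{P}(K)$ is the set of unordered pairs $\{p,q\}$ of distinct classical crossings of $K$ such that the oriented smoothing of $K$ at both $p$ and $q$ is a three-component virtual link diagram (equivalently,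 the arrows $p,q$ do not intersect). Define $\Phi^{fr}(K)=\prod_{\{p,q\}\in\mathcal{P}(K)}A_{w(p)\,w(q)}$. *)

theory Defs
  imports
    "HOL-Analysis.Analysis"
    "HOL-Algebra.Free_Abelian_Groups"
    "HOL-Combinatorics.Orbits"
begin

section \<open>Virtual knot diagrams\<close>

text \<open>
  The plane is \<^typ>\<open>complex\<close>; a closed curve is a function on \<^typ>\<open>real\<close> of period 1, so
  parameters that differ by an integer denote the same point of the source circle.
  The mark of a parameter tells what the strand does there: it passes through no double point
  (\<open>Simple\<close>), it is the over or the under strand of a classical crossing, or it
  runs through a virtual crossing.
\<close>

datatype passage = Simple | Over | Under | Virtual

fun opposite :: "passage \<Rightarrow> passage" where
  "opposite Over = Under"
| "opposite Under = Over"
| "opposite Virtual = Virtual"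
| "opposite Simple = Simple"

record diagram =
  curve :: "real \<Rightarrow> complex"
  mark :: "real \<Rightarrow> passage"

text \<open>The determinant of the pair of plane vectors \<open>z, w\<close>.\<close>

definition turn :: "complex \<Rightarrow> complex \<Rightarrow> real" where
  "turn z w = Im (cnj z * w)"

definition velocity :: "diagram \<Rightarrow> real \<Rightarrow> complex" where
  "velocity D t = vector_derivative (curve D) (at t)"

definition double_point :: "diagram \<Rightarrow> real \<Rightarrow> real \<Rightarrow> bool" where
  "double_point D s t \<longleftrightarrow> s - t \<notin> \<int> \<and> curve D s = curve D t"

definition virtual_knot_diagram :: "diagram \<Rightarrow> bool" where
  "virtual_knot_diagram D \<longleftrightarrow>
     (\<forall>t. curve D (t + 1) = curve D t) \<and>
     curve D C1_differentiable_on UNIV \<and>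
     (\<forall>t. velocity D t \<noteq> 0) \<and>
     finite {(s, t). s \<in> {0..<1} \<and> t \<in> {0..<1} \<and> double_point D s t} \<and>
     \<not> (\<exists>s t u. double_point D s t \<and> double_point D s u \<and> double_point D t u) \<and>
     (\<forall>s t. double_point D s t \<longrightarrow> turn (velocity D s) (velocity D t) \<noteq> 0) \<and>
     (\<forall>s t. double_point D s t \<longrightarrow> mark D s \<noteq> Simple \<and> mark D t = opposite (mark D s)) \<and>
     (\<forall>s. (\<nexists>t. double_point D s t) \<longrightarrow> mark D s = Simple)"


section \<open>Framed virtual knots\<close>

text \<open>Orientation preserving \<open>C\<^sup>1\<close> diffeomorphisms of the plane (the inverse is \<open>C\<^sup>1\<close> because the
  Jacobian does not vanish) and of the source circle, the latter lifted to the line.\<close>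

definition plane_diffeo :: "(complex \<Rightarrow> complex) \<Rightarrow> bool" where
  "plane_diffeo h \<longleftrightarrow> bij h \<and>
     (\<exists>h'. (\<forall>z. (h has_derivative h' z) (at z)) \<and>
           (\<forall>v. continuous_on UNIV (\<lambda>z. h' z v)) \<and>
           (\<forall>z. turn (h' z 1) (h' z \<i>) > 0))"

definition circle_diffeo :: "(real \<Rightarrow> real) \<Rightarrow> bool" where
  "circle_diffeo f \<longleftrightarrow> (\<forall>t. f (t + 1) = f t + 1) \<and>
     f C1_differentiable_on UNIV \<and> (\<forall>t. deriv f t > 0)"

definition plane_isotopy :: "(real \<Rightarrow> complex \<Rightarrow> complex) \<Rightarrow> bool" where
  "plane_isotopy H \<longleftrightarrow> H 0 = id \<and> (\<forall>s\<in>{0..1}. plane_diffeo (H s)) \<and>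
     continuous_on ({0..1} \<times> UNIV) (\<lambda>(s, z). H s z)"

text \<open>
  A Reidemeister move replaces one standard picture in a disk by another one. A picture is a list of
  marked strands, each parametrised by \<open>{-1..1}\<close>, in the square \<open>[-1,1]\<^sup>2\<close>; strands enter and leave
  through the left and the right side of the square.
\<close>

type_synonym picture = "((real \<Rightarrow> complex) \<times> (real \<Rightarrow> passage)) list"

abbreviation unmarked :: "real \<Rightarrow> passage" where
  "unmarked \<equiv> \<lambda>_. Simple"

definition unit_square :: "complex set" where
  "unit_square = {z. \<bar>Re z\<bar> \<le> 1 \<and> \<bar>Im z\<bar> \<le> 1}"

text \<open>A strand without crossings, and a curl (on the nodal cubic) whose crossing is virtual.\<close>

definition strand_picture :: picture where
  "strand_picture = [(\<lambda>u. Complex u (1/2), unmarked)]"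

definition virtual_curl_picture :: picture where
  "virtual_curl_picture =
     [(\<lambda>u. Complex ((4 * u^3 - u) / 3) (u^2 / 2),
       unmarked(-1/2 := Virtual, 1/2 := Virtual))]"

text \<open>Two disjoint strands, and two strands with two crossings; \<open>m\<close> describes the first strand,
  which is over, under or virtual at both of them.\<close>

definition parallel_picture :: picture where
  "parallel_picture = [(\<lambda>u. Complex u 0, unmarked), (\<lambda>u. Complex u (1/2), unmarked)]"

definition bigon_picture :: "passage \<Rightarrow> picture" where
  "bigon_picture m =
     [(\<lambda>u. Complex u 0, unmarked(-1/2 := m, 1/2 := m)),
      (\<lambda>u. Complex u (u^2 - 1/4), unmarked(-1/2 := opposite m, 1/2 := opposite m))]"

text \<open>Three strands on the lines \<open>y = x/2\<close>, \<open>y = -x/2\<close> and \<open>y = e\<close>. Strands \<open>i < j\<close> have one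
  crossing, where the mark of strand \<open>i\<close> is \<open>mij\<close>. Changing the sign of \<open>e\<close> moves the third strand
  across the crossing of the other two.\<close>

definition triangle_picture :: "real \<Rightarrow> passage \<Rightarrow> passage \<Rightarrow> passage \<Rightarrow> picture" where
  "triangle_picture e m12 m13 m23 =
     [(\<lambda>u. Complex u (u / 2), unmarked(0 := m12, 2 * e := m13)),
      (\<lambda>u. Complex u (- u / 2), unmarked(0 := opposite m12, - 2 * e := m23)),
      (\<lambda>u. Complex u e, unmarked(2 * e := opposite m13, - 2 * e := opposite m23))]"

text \<open>The admissible marks of the third moves: all crossings classical, with the strands at three
  different heights, or one strand virtual at both of its crossings. The latter includes the mixed
  move and the purely virtual one; a virtual crossing together with two classical ones is excluded,
  as this would give the forbidden moves.\<close>

definition by_height :: "nat \<Rightarrow> nat \<Rightarrow> passage" where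
  "by_height a b = (if a > b then Over else Under)"

inductive triangle_marks :: "passage \<Rightarrow> passage \<Rightarrow> passage \<Rightarrow> bool" where
  classical: "distinct [a, b, c] \<Longrightarrow> triangle_marks (by_height a b) (by_height a c) (by_height b c)"
| detour1: "m \<noteq> Simple \<Longrightarrow> triangle_marks Virtual Virtual m"
| detour2: "m \<noteq> Simple \<Longrightarrow> triangle_marks Virtual m Virtual"
| detour3: "m \<noteq> Simple \<Longrightarrow> triangle_marks m Virtual Virtual"

text \<open>All extended Reidemeister moves except the classical first one. Other
  orientations of the strands need no separate pictures, see \<open>shows_picture\<close>.\<close>

inductive framed_reidemeister :: "picture \<Rightarrow> picture \<Rightarrow> bool" where
  R1_virtual: "framed_reidemeister strand_picture virtual_curl_picture"
| R2: "m \<noteq> Simple \<Longrightarrow> framed_reidemeister parallel_picture (bigon_picture m)"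
| R3: "triangle_marks m12 m13 m23 \<Longrightarrow>
    framed_reidemeister (triangle_picture (1/4) m12 m13 m23) (triangle_picture (-1/4) m12 m13 m23)"

text \<open>The affine map from \<open>{-1..1}\<close> to the interval with end points \<open>fst I\<close> and \<open>snd I\<close>; it reverses
  the orientation if \<open>snd I < fst I\<close>.\<close>

definition on_interval :: "real \<times> real \<Rightarrow> real \<Rightarrow> real" where
  "on_interval I u = ((1 - u) * fst I + (1 + u) * snd I) / 2"

text \<open>The part of \<open>D\<close> in the disk \<open>h ` unit_square\<close> is the image under \<open>h\<close> of the picture \<open>T\<close>, and the
  strands of \<open>T\<close> occupy the pairwise disjoint parameter intervals \<open>Is\<close> on the circle, traversed in
  either direction.\<close>

definition shows_picture ::
  "diagram \<Rightarrow> (complex \<Rightarrow> complex) \<Rightarrow> (real \<times> real) list \<Rightarrow> picture \<Rightarrow> bool" where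
  "shows_picture D h Is T \<longleftrightarrow> plane_diffeo h \<and> length Is = length T \<and>
     (\<forall>i<length T. \<forall>j<length T. \<forall>u\<in>{-1..1}. \<forall>v\<in>{-1..1}.
        on_interval (Is ! i) u - on_interval (Is ! j) v \<in> \<int> \<longrightarrow> i = j \<and> u = v) \<and>
     (\<forall>i<length T. \<forall>u\<in>{-1..1}.
        curve D (on_interval (Is ! i) u) = h (fst (T ! i) u) \<and>
        mark D (on_interval (Is ! i) u) = snd (T ! i) u) \<and>
     (\<forall>t. curve D t \<in> h ` unit_square \<longrightarrow>
        (\<exists>i<length T. \<exists>u\<in>{-1..1}. t - on_interval (Is ! i) u \<in> \<int>))"

text \<open>In a local move the diagrams agree outside of the disk. The charts \<open>h\<close> and \<open>k\<close> of the disk may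
  differ: the strands of both pictures have the same ends on its boundary by continuity, and
  the standard pictures list these ends in the same cyclic order.\<close>

inductive framed_move :: "diagram \<Rightarrow> diagram \<Rightarrow> bool" where
  reparametrise:
    "circle_diffeo f \<Longrightarrow> framed_move D \<lparr>curve = curve D \<circ> f, mark = mark D \<circ> f\<rparr>"
| isotopy:
    "plane_isotopy H \<Longrightarrow> framed_move D \<lparr>curve = H 1 \<circ> curve D, mark = mark D\<rparr>"
| reidemeister:
    "framed_reidemeister T T' \<Longrightarrow> shows_picture D h Is T \<Longrightarrow> shows_picture D' k Is T' \<Longrightarrow>
     h ` unit_square = k ` unit_square \<Longrightarrow>
     (\<And>t. curve D t \<notin> h ` unit_square \<Longrightarrow> curve D' t = curve D t \<and> mark D' t = mark D t) \<Longrightarrow>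
     framed_move D D'"

definition framed_equiv :: "(diagram \<times> diagram) set" where
  "framed_equiv = {(D, D'). virtual_knot_diagram D \<and> virtual_knot_diagram D' \<and>
     equivclp (\<lambda>E E'. virtual_knot_diagram E \<and> virtual_knot_diagram E' \<and> framed_move E E') D D'}"

definition framed_virtual_knots :: "diagram set set" where
  "framed_virtual_knots = {D. virtual_knot_diagram D} // framed_equiv"


section \<open>Arrows and weights\<close>

text \<open>A classical crossing is the pair of its over and its under parameter in \<open>{0..<1}\<close>. As an arrow of
  the Gauss diagram it is the chord of the unit circle from \<open>tail\<close> to \<open>head\<close>.\<close>

type_synonym arrow = "real \<times> real"

definition arrows :: "diagram \<Rightarrow> arrow set" where
  "arrows D = {(s, t). s \<in> {0..<1} \<and> t \<in> {0..<1} \<and> double_point D s t \<and>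
     mark D s = Over \<and> mark D t = Under}"

text \<open>Positive crossings are those where the over strand has to be turned counterclockwise to get to
  the under strand.\<close>

definition crossing_sign :: "diagram \<Rightarrow> arrow \<Rightarrow> int" where
  "crossing_sign D c = (if turn (velocity D (fst c)) (velocity D (snd c)) > 0 then 1 else -1)"

definition tail :: "arrow \<Rightarrow> complex" where
  "tail c = cis (2 * pi * fst c)"

definition head :: "arrow \<Rightarrow> complex" where
  "head c = cis (2 * pi * snd c)"

definition intersects :: "arrow \<Rightarrow> arrow \<Rightarrow> bool" where
  "intersects c x \<longleftrightarrow> x \<noteq> c \<and>
     closed_segment (tail c) (head c) \<inter> closed_segment (tail x) (head x) \<noteq> {}"

text \<open>If \<open>c\<close> points upward, an arrow that crosses \<open>c\<close> from left to right is directed clockwise from it.\<close>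

definition int_sign :: "arrow \<Rightarrow> arrow \<Rightarrow> int" where
  "int_sign c x = (if turn (head c - tail c) (head x - tail x) < 0 then 1 else -1)"

definition weight :: "diagram \<Rightarrow> arrow \<Rightarrow> int" where
  "weight D c = (\<Sum>x\<in>{x \<in> arrows D. intersects c x}. crossing_sign D x * int_sign c x)"


section \<open>Oriented smoothings\<close>

text \<open>Smoothing a set \<open>S\<close> of crossings cuts the circle at the end points of their arrows. Along the
  orientation, the arc that starts at \<open>v\<close> runs to the next cut point; oriented smoothing
  joins it to the arc that starts at the other preimage of the crossing reached there. The components
  of the smoothed diagram are the cycles of arcs, given by the starting points of the arcs.\<close>

definition cut_points :: "arrow set \<Rightarrow> real set" where
  "cut_points S = fst ` S \<union> snd ` S"

definition next_cut :: "arrow set \<Rightarrow> real \<Rightarrow> real" where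
  "next_cut S v = (ARG_MIN (\<lambda>w. frac (w - v)) w. w \<in> cut_points S \<and> w \<noteq> v)"

definition partner :: "arrow set \<Rightarrow> real \<Rightarrow> real" where
  "partner S v = (THE w. (v, w) \<in> S \<or> (w, v) \<in> S)"

definition smoothing_components :: "arrow set \<Rightarrow> real set set" where
  "smoothing_components S = orbit (\<lambda>v. partner S (next_cut S v)) ` cut_points S"

definition three_loop_pairs :: "diagram \<Rightarrow> arrow set set" where
  "three_loop_pairs D =
     {S. S \<subseteq> arrows D \<and> card S = 2 \<and> card (smoothing_components S) = 3}"

lemma finite_arrows:
  assumes "virtual_knot_diagram D"
  shows "finite (arrows D)"
proof (rule finite_subset)
  show "arrows D \<subseteq> {(s, t). s \<in> {0..<1} \<and> t \<in> {0..<1} \<and> double_point D s t}"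
    by (auto simp: arrows_def)
qed (use assms in \<open>simp add: virtual_knot_diagram_def\<close>)

lemma finite_three_loop_pairs:
  assumes "virtual_knot_diagram D"
  shows "finite (three_loop_pairs D)"
  by (rule finite_subset[of _ "Pow (arrows D)"])
     (use finite_arrows[OF assms] in \<open>auto simp: three_loop_pairs_def\<close>)


section \<open>The group \<open>A\<close>\<close>

text \<open>Words in the symbols \<open>A\<^bsub>ij\<^esub>\<close> (flag \<open>True\<close>) and their formal inverses (flag \<open>False\<close>).\<close>

type_synonym word = "((int \<times> int) \<times> bool) list"

inductive word_eq :: "word \<Rightarrow> word \<Rightarrow> bool" where
  refl: "word_eq v v"
| sym: "word_eq v w \<Longrightarrow> word_eq w v"
| trans: "word_eq u v \<Longrightarrow> word_eq v w \<Longrightarrow> word_eq u w"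
| append: "word_eq v v' \<Longrightarrow> word_eq w w' \<Longrightarrow> word_eq (v @ w) (v' @ w')"
| cancel: "word_eq [(g, b), (g, \<not> b)] []"
| unit: "word_eq [((i, i), True)] []"
| square: "word_eq [((i, j), True), ((i, j), True)] []"
| commute: "word_eq [((i, j), True), ((l, m), True)] [((l, m), True), ((i, j), True)]"
| compose: "word_eq [((i, j), True), ((j, k), True)] [((i, k), True)]"

definition word_class :: "word \<Rightarrow> word set" where
  "word_class v = {w. word_eq v w}"

definition A_group :: "word set monoid" where
  "A_group = \<lparr>carrier = range word_class,
     monoid.mult = (\<lambda>X Y. {z. \<exists>x\<in>X. \<exists>y\<in>Y. word_eq (x @ y) z}),
     one = word_class []\<rparr>"

definition A_gen :: "int \<Rightarrow> int \<Rightarrow> word set" where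
  "A_gen i j = word_class [((i, j), True)]"

lemma word_class_eq_iff: "word_class v = word_class w \<longleftrightarrow> word_eq v w"
proof
  assume "word_class v = word_class w"
  then have "w \<in> word_class v" by (simp add: word_class_def word_eq.refl)
  then show "word_eq v w" by (simp add: word_class_def)
next
  assume vw: "word_eq v w"
  have "word_eq v z \<longleftrightarrow> word_eq w z" for z
    using word_eq.trans[OF vw] word_eq.trans[OF word_eq.sym[OF vw]] by blast
  then show "word_class v = word_class w" by (simp add: word_class_def)
qed

lemma A_mult_word_class:
  "word_class v \<otimes>\<^bsub>A_group\<^esub> word_class w = word_class (v @ w)"
proof -
  have "(\<exists>x. word_eq v x \<and> (\<exists>y. word_eq w y \<and> word_eq (x @ y) z)) \<longleftrightarrow> word_eq (v @ w) z" for z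
  proof
    assume "\<exists>x. word_eq v x \<and> (\<exists>y. word_eq w y \<and> word_eq (x @ y) z)"
    then obtain x y where "word_eq v x" "word_eq w y" and z: "word_eq (x @ y) z" by blast
    then have "word_eq (v @ w) (x @ y)" by (intro word_eq.append)
    then show "word_eq (v @ w) z" using z by (rule word_eq.trans)
  qed (use word_eq.refl in blast)
  then show ?thesis by (simp add: A_group_def word_class_def)
qed

lemma word_eq_inverse: "\<exists>w. word_eq (w @ v) []"
proof (induction v)
  case Nil
  show ?case using word_eq.refl by auto
next
  case (Cons a v)
  then obtain w where w: "word_eq (w @ v) []" by blast
  obtain g b where a: "a = (g, b)" by (cases a)
  have "word_eq ([(g, \<not> b)] @ [(g, b)]) []"
    using word_eq.cancel[of g "\<not> b"] by simp
  then have "word_eq (w @ ([(g, \<not> b), (g, b)] @ v)) (w @ ([] @ v))"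
    by (intro word_eq.append word_eq.refl) simp
  then have "word_eq ((w @ [(g, \<not> b)]) @ a # v) (w @ v)"
    using a by simp
  then have "word_eq ((w @ [(g, \<not> b)]) @ a # v) []"
    using w by (rule word_eq.trans)
  then show ?case by blast
qed

lemma word_eq_letter: "word_eq [(g, b)] [(g, True)]"
proof (cases b)
  case False
  obtain i j where g: "g = (i, j)" by (cases g)
  have "word_eq ([(g, False)] @ [(g, True), (g, True)]) ([(g, False)] @ [])"
    unfolding g by (intro word_eq.append word_eq.refl word_eq.square)
  moreover have "word_eq ([(g, False), (g, True)] @ [(g, True)]) ([] @ [(g, True)])"
    using word_eq.cancel[of g False] by (intro word_eq.append word_eq.refl) simp
  ultimately have "word_eq [(g, False)] [(g, False), (g, True), (g, True)]"
    and "word_eq [(g, False), (g, True), (g, True)] [(g, True)]"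
    by (simp_all add: word_eq.sym)
  then show ?thesis
    using False by (simp add: word_eq.trans[of "[(g, False)]"])
qed (auto intro: word_eq.refl)

lemma word_eq_commute_letter: "word_eq (a # w) (w @ [a])"
proof (induction w)
  case (Cons b w)
  obtain i j x l m y where ab: "a = ((i, j), x)" "b = ((l, m), y)"
    by (metis surj_pair)
  have "word_eq ([a] @ [b]) ([((i, j), True)] @ [((l, m), True)])"
    unfolding ab by (intro word_eq.append word_eq_letter)
  moreover have "word_eq ([b] @ [a]) ([((l, m), True)] @ [((i, j), True)])"
    unfolding ab by (intro word_eq.append word_eq_letter)
  ultimately have "word_eq [a, b] [((i, j), True), ((l, m), True)]"
    and "word_eq [((l, m), True), ((i, j), True)] [b, a]"
    by (simp_all add: word_eq.sym)
  then have "word_eq [a, b] [b, a]"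
    by (rule word_eq.trans[OF _ word_eq.trans[OF word_eq.commute]])
  then have "word_eq ([a, b] @ w) ([b, a] @ w)"
    by (intro word_eq.append word_eq.refl)
  moreover have "word_eq ([b] @ (a # w)) ([b] @ (w @ [a]))"
    using Cons by (intro word_eq.append word_eq.refl)
  ultimately have "word_eq (a # b # w) (b # a # w)" and "word_eq (b # a # w) (b # w @ [a])"
    by simp_all
  then have "word_eq (a # b # w) (b # w @ [a])" by (rule word_eq.trans)
  then show ?case by simp
qed (simp add: word_eq.refl)

lemma word_eq_commute: "word_eq (v @ w) (w @ v)"
proof (induction v arbitrary: w)
  case (Cons a v)
  have "word_eq (a # (v @ w)) ((v @ w) @ [a])"
    by (rule word_eq_commute_letter)
  then have "word_eq (a # (v @ w)) (v @ (w @ [a]))" by simp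
  then have "word_eq (a # (v @ w)) ((w @ [a]) @ v)"
    using Cons by (rule word_eq.trans)
  then show ?case by simp
qed (simp add: word_eq.refl)

lemma comm_group_A_group: "comm_group A_group"
proof (rule comm_groupI)
  have carrier: "carrier A_group = range word_class" and one: "\<one>\<^bsub>A_group\<^esub> = word_class []"
    by (simp_all add: A_group_def)
  note simps = carrier one A_mult_word_class word_class_eq_iff
  show "x \<otimes>\<^bsub>A_group\<^esub> y \<in> carrier A_group"
    if "x \<in> carrier A_group" "y \<in> carrier A_group" for x y
    using that by (auto simp: simps)
  show "\<one>\<^bsub>A_group\<^esub> \<in> carrier A_group"
    by (auto simp: carrier one)
  show "x \<otimes>\<^bsub>A_group\<^esub> y \<otimes>\<^bsub>A_group\<^esub> z = x \<otimes>\<^bsub>A_group\<^esub> (y \<otimes>\<^bsub>A_group\<^esub> z)"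
    if "x \<in> carrier A_group" "y \<in> carrier A_group" "z \<in> carrier A_group" for x y z
    using that by (auto simp: simps word_eq.refl)
  show "x \<otimes>\<^bsub>A_group\<^esub> y = y \<otimes>\<^bsub>A_group\<^esub> x"
    if xy: "x \<in> carrier A_group" "y \<in> carrier A_group" for x y
  proof -
    obtain v w where "x = word_class v" "y = word_class w"
      using xy by (auto simp: carrier)
    then show ?thesis by (simp add: simps word_eq_commute)
  qed
  show "\<one>\<^bsub>A_group\<^esub> \<otimes>\<^bsub>A_group\<^esub> x = x" if "x \<in> carrier A_group" for x
    using that by (auto simp: simps word_eq.refl)
  show "\<exists>y\<in>carrier A_group. y \<otimes>\<^bsub>A_group\<^esub> x = \<one>\<^bsub>A_group\<^esub>" if x_in: "x \<in> carrier A_group" for x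
  proof -
    obtain v where x: "x = word_class v" using x_in by (auto simp: carrier)
    obtain w where "word_eq (w @ v) []" using word_eq_inverse by blast
    then have "word_class w \<otimes>\<^bsub>A_group\<^esub> x = \<one>\<^bsub>A_group\<^esub>" by (simp add: x simps)
    then show ?thesis by (auto simp: carrier)
  qed
qed

lemma A_gen_sym: "A_gen i j = A_gen j i"
proof -
  let ?a = "[((i, j), True)]" and ?b = "[((j, i), True)]"
  have "word_eq (?a @ (?a @ ?b)) (?a @ [])"
    using word_eq.trans[OF word_eq.compose[of i j i] word_eq.unit]
    by (intro word_eq.append word_eq.refl) simp
  moreover have "word_eq ((?a @ ?a) @ ?b) ([] @ ?b)"
    using word_eq.square[of i j] by (intro word_eq.append word_eq.refl) simp
  ultimately have "word_eq ?a (?a @ ?a @ ?b)" and "word_eq (?a @ ?a @ ?b) ?b"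
    by (simp_all add: word_eq.sym)
  then have "word_eq ?a ?b" by (rule word_eq.trans)
  then show ?thesis by (simp add: A_gen_def word_class_eq_iff)
qed


section \<open>The three loop framed isotopy map\<close>

text \<open>The description is unambiguous because of the lemma \<open>A_gen_sym\<close>.\<close>

definition pair_gen :: "diagram \<Rightarrow> arrow set \<Rightarrow> word set" where
  "pair_gen D S =
     (THE g. \<exists>p q. S = {p, q} \<and> p \<noteq> q \<and> g = A_gen (weight D p) (weight D q))"

lemma pair_gen_eq: "p \<noteq> q \<Longrightarrow> pair_gen D {p, q} = A_gen (weight D p) (weight D q)"
  unfolding pair_gen_def
  by (rule the_equality)
     (blast, metis A_gen_sym doubleton_eq_iff)

definition Phi_fr :: "diagram \<Rightarrow> word set" where
  "Phi_fr D = (\<Otimes>\<^bsub>A_group\<^esub> S\<in>three_loop_pairs D. pair_gen D S)"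

end

theory Submission
  imports Defs
begin

text \<open>The weight of a crossing is an intersection number. Walk along the knot from the over passage of
  \<open>c\<close> to its under passage: an arrow \<open>x\<close> intersects \<open>c\<close> exactly if the walk meets one of the two ends
  of \<open>x\<close>, and \<open>sign(x) int\<^sub>c(x)\<close> depends only on which end this is. Hence \<open>w(c)\<close> is a sum, over all
  classical passages met on the walk, of a sign \<open>crossing_index\<close> that is determined locally: it says
  from which side the other strand crosses (\<open>weight_eq_arc_index\<close>). In this form
  the effect of a local change of the diagram on the weights can be read off from the picture
  in the disk.
  
  The invariant depends on the weights only. Since \<open>A\<^sub>i\<^sub>j = A\<^sub>0\<^sub>i A\<^sub>0\<^sub>j\<close> and the group is abelian of
  exponent two, \<open>\<Phi>\<^sup>f\<^sup>r\<close> is the product over all crossings \<open>c\<close> of \<open>A\<^sub>0\<^sub>,\<^sub>w\<^sub>(\<^sub>c\<^sub>)\<close> raised to the number of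
  crossings that do not intersect \<open>c\<close>. The weight is a sum of one sign for each crossing that does
  intersect \<open>c\<close>, so this exponent has the parity of \<open>n - 1 - w(c)\<close>, where \<open>n\<close> is the number of
  crossings (\<open>Phi_fr_eq_product\<close>). So the multiset of weights determines \<open>\<Phi>\<^sup>f\<^sup>r\<close>, two
  additional crossings of equal weight cancel, and every change of the set of three loop pairs is
  accounted for by the weights.
  
  A change of parameter or a diffeomorphism of the plane preserves the cyclic order of the passages and the sides from
  which strands cross (\<open>Phi_fr_relabel\<close>). For a Reidemeister move the walks are split into the part outside of the
  disk, which is common to both diagrams, and the part inside, which is a finite computation
  in the standard pictures. A second move adds two adjacent passages of opposite index to each of
  its two strands. This does not change the other weights, and the two new crossings have
  equal weights. In a third move with three classical crossings, the two passages on each strand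
  change places. For the crossing of strands \<open>i\<close> and \<open>j\<close> this changes the walk by the passage of \<open>i\<close>
  and the passage of \<open>j\<close> at the third strand, and their contributions cancel
  (\<open>triangle_inner_index\<close>). In all other moves no strand in the disk has two classical passages.\<close>

section \<open>Cyclic order on the circle\<close>

text \<open>The circle is the line modulo 1, and \<open>p\<close> lies on the open arc that runs from \<open>a\<close> to \<open>b\<close> in the
  positive direction. All arguments are parameters on the line, so that no
  representatives have to be chosen.\<close>

definition cyc :: "real \<Rightarrow> real \<Rightarrow> real \<Rightarrow> bool" where
  "cyc a p b \<longleftrightarrow> 0 < frac (p - a) \<and> frac (p - a) < frac (b - a)"

lemma frac_eqI: "z - r \<in> \<int> \<Longrightarrow> 0 \<le> r \<Longrightarrow> r < 1 \<Longrightarrow> frac z = r"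
  by (simp add: frac_unique_iff)

lemma frac_cong_Ints: "x - y \<in> \<int> \<Longrightarrow> frac x = frac y"
  using frac_add_int_right[of "x - y" y] by simp

lemma frac_eq_imp_Ints:
  assumes "frac x = frac y" shows "x - y \<in> \<int>"
proof -
  have "x - y = of_int (\<lfloor>x\<rfloor> - \<lfloor>y\<rfloor>)" using assms by (simp add: frac_def)
  then show ?thesis by (metis Ints_of_int)
qed

lemma diff_frac_Ints: "x - frac x \<in> \<int>" "frac x - x \<in> \<int>"
  by (simp_all add: frac_def)

lemma cyc_cong_Ints:
  assumes "a - a' \<in> \<int>" "p - p' \<in> \<int>" "b - b' \<in> \<int>"
  shows "cyc a p b \<longleftrightarrow> cyc a' p' b'"
proof -
  have "(p - a) - (p' - a') \<in> \<int>" "(b - a) - (b' - a') \<in> \<int>"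
    using Ints_diff[OF assms(2,1)] Ints_diff[OF assms(3,1)] by (simp_all add: algebra_simps)
  then show ?thesis
    by (simp add: cyc_def frac_cong_Ints)
qed

lemma cyc_frac [simp]:
  "cyc (frac a) p b \<longleftrightarrow> cyc a p b"
  "cyc a (frac p) b \<longleftrightarrow> cyc a p b"
  "cyc a p (frac b) \<longleftrightarrow> cyc a p b"
  by (rule cyc_cong_Ints; simp add: diff_frac_Ints)+

lemma cyc_offsets:
  assumes "cyc a p b"
  shows "frac (b - p) = frac (b - a) - frac (p - a)" "frac (a - p) = 1 - frac (p - a)"
proof -
  have "(b - p) - (frac (b - a) - frac (p - a)) \<in> \<int>"
    by (simp add: frac_def)
  then show "frac (b - p) = frac (b - a) - frac (p - a)"
    using assms frac_lt_1[of "b - a"] frac_ge_0[of "p - a"] unfolding cyc_def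
    by (intro frac_eqI) linarith+
  have "(a - p) - (1 - frac (p - a)) \<in> \<int>"
    by (simp add: frac_def)
  then show "frac (a - p) = 1 - frac (p - a)"
    using assms frac_lt_1[of "p - a"] unfolding cyc_def
    by (intro frac_eqI) linarith+
qed

lemma cyc_rotate: "cyc a p b \<longleftrightarrow> cyc p b a"
proof -
  have step: "cyc p b a" if "cyc a p b" for a p b
  proof -
    have "frac (b - a) < 1" by (rule frac_lt_1)
    then show ?thesis using cyc_offsets[OF that] that unfolding cyc_def by linarith
  qed
  show ?thesis using step by blast
qed

lemma cyc_refl [simp]: "\<not> cyc a a b" "\<not> cyc a b b" "\<not> cyc a b a"
  by (auto simp: cyc_def dest: order.strict_trans) (metis frac_ge_0 not_le)

lemma cyc_total:
  assumes "p - a \<notin> \<int>" "p - b \<notin> \<int>" "b - a \<notin> \<int>"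
  shows "cyc b p a \<longleftrightarrow> \<not> cyc a p b"
proof -
  have "cyc b p a \<longleftrightarrow> cyc a b p" by (metis cyc_rotate)
  moreover have "frac (p - a) \<noteq> frac (b - a)"
  proof
    assume "frac (p - a) = frac (b - a)"
    then have "p - b = of_int (\<lfloor>p - a\<rfloor> - \<lfloor>b - a\<rfloor>)" by (simp add: frac_def)
    then show False using assms(2) by (metis Ints_of_int)
  qed
  moreover have "0 < frac (p - a)" "0 < frac (b - a)"
    using assms by auto
  ultimately show ?thesis unfolding cyc_def by linarith
qed

section \<open>Chords of the circle\<close>

lemma turn_coords: "turn z w = Re z * Im w - Im z * Re w"
  by (simp add: turn_def)

lemma turn_linear:
  "turn z (w + w') = turn z w + turn z w'"
  "turn z (w - w') = turn z w - turn z w'"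
  "turn z (r *\<^sub>R w) = r * turn z w"
  "turn (r *\<^sub>R z) w = r * turn z w"
  by (simp_all add: turn_coords algebra_simps)

lemma turn_self [simp]: "turn z z = 0"
  by (simp add: turn_coords)

lemma turn_swap: "turn w z = - turn z w"
  by (simp add: turn_coords)

lemma turn_eq_0_imp_scaleR:
  assumes "turn z w = 0" "z \<noteq> 0"
  obtains s where "w = s *\<^sub>R z"
proof
  let ?n = "(Re z)\<^sup>2 + (Im z)\<^sup>2"
  have n: "?n \<noteq> 0" using assms(2) by (simp add: complex_eq_iff)
  let ?s = "(Re z * Re w + Im z * Im w) / ?n"
  have eq: "Re z * Im w = Im z * Re w" using assms(1) by (simp add: turn_coords)
  have "?n * Re w = (Re z * Re w + Im z * Im w) * Re z"
    using eq by (simp add: algebra_simps power2_eq_square)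
  moreover have "?n * Im w = (Re z * Re w + Im z * Im w) * Im z"
    using eq by (simp add: algebra_simps power2_eq_square)
  ultimately show "w = ?s *\<^sub>R z"
    using n by (simp add: complex_eq_iff field_simps)
qed

definition circ :: "real \<Rightarrow> complex" where
  "circ t = cis (2 * pi * t)"

lemma circ_add: "circ (s + t) = circ s * circ t"
  by (simp add: circ_def cis_mult algebra_simps)

lemma circ_frac: "circ (frac t) = circ t"
proof -
  have "circ (frac t + of_int \<lfloor>t\<rfloor>) = circ (frac t) * circ (of_int \<lfloor>t\<rfloor>)"
    by (rule circ_add)
  moreover have "circ (of_int \<lfloor>t\<rfloor>) = 1"
    unfolding circ_def by (rule cis_multiple_2pi) simp
  ultimately show ?thesis by (simp add: frac_def)
qed

text \<open>After a rotation that moves \<open>a\<close> to 0 this is the formula for the signed area of a triangle inscribed in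
  the unit circle, as a product of the sines of half of its central angles.\<close>

lemma turn_circ:
  "turn (circ b - circ a) (circ p - circ a) =
     4 * sin (pi * frac (b - a)) * sin (pi * frac (p - a)) * sin (pi * (frac (p - a) - frac (b - a)))"
proof -
  let ?x = "frac (p - a)" and ?y = "frac (b - a)"
  have "circ p = circ a * circ ?x" "circ b = circ a * circ ?y"
    by (metis circ_add circ_frac add.commute diff_add_cancel)+
  then have "turn (circ b - circ a) (circ p - circ a)
      = turn (circ a * (circ ?y - 1)) (circ a * (circ ?x - 1))"
    by (simp add: algebra_simps)
  also have "\<dots> = Im ((cnj (circ a) * circ a) * (cnj (circ ?y - 1) * (circ ?x - 1)))"
    by (simp only: turn_def complex_cnj_mult mult_ac)
  also have "cnj (circ a) * circ a = 1"
    by (simp add: circ_def cis_cnj cis_mult)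
  also have "Im (1 * (cnj (circ ?y - 1) * (circ ?x - 1))) =
      (cos (2 * (pi * ?y)) - 1) * sin (2 * (pi * ?x)) - sin (2 * (pi * ?y)) * (cos (2 * (pi * ?x)) - 1)"
    by (simp add: circ_def mult_ac)
  also have "\<dots> = 4 * sin (pi * ?y) * sin (pi * ?x) *
      (sin (pi * ?x) * cos (pi * ?y) - cos (pi * ?x) * sin (pi * ?y))"
    by (simp only: cos_double_sin sin_double) (simp add: algebra_simps power2_eq_square)
  also have "sin (pi * ?x) * cos (pi * ?y) - cos (pi * ?x) * sin (pi * ?y) = sin (pi * (?x - ?y))"
    by (simp add: right_diff_distrib sin_diff)
  finally show ?thesis .
qed

lemma sin_pi_times_pos: "0 < x \<Longrightarrow> x < 1 \<Longrightarrow> 0 < sin (pi * x)"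
  by (intro sin_gt_zero) auto

lemma turn_circ_neg_iff: "turn (circ b - circ a) (circ p - circ a) < 0 \<longleftrightarrow> cyc a p b"
  and turn_circ_pos_iff: "turn (circ b - circ a) (circ p - circ a) > 0 \<longleftrightarrow> cyc b p a"
proof -
  let ?x = "frac (p - a)" and ?y = "frac (b - a)"
  have bounds: "0 \<le> ?x" "?x < 1" "0 \<le> ?y" "?y < 1" by (simp_all add: frac_lt_1)
  let ?t = "turn (circ b - circ a) (circ p - circ a)"
  have rot: "cyc b p a \<longleftrightarrow> cyc a b p" by (metis cyc_rotate)
  consider "?x = 0 \<or> ?y = 0 \<or> ?x = ?y" | "0 < ?x" "?x < ?y" | "0 < ?y" "?y < ?x"
    using bounds by linarith
  then have "(?t < 0 \<longleftrightarrow> cyc a p b) \<and> (?t > 0 \<longleftrightarrow> cyc a b p)"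
  proof cases
    case 1
    then have "sin (pi * ?x) = 0 \<or> sin (pi * ?y) = 0 \<or> sin (pi * (?x - ?y)) = 0" using sin_zero by (elim disjE) (simp_all only: mult_zero_right diff_self sin_zero simp_thms)
    then have "?t = 0" unfolding turn_circ by auto
    moreover have "\<not> cyc a p b" "\<not> cyc a b p" using 1 bounds unfolding cyc_def by linarith+
    ultimately show ?thesis by simp
  next
    case 2
    then have "0 < sin (pi * ?x)" "0 < sin (pi * ?y)" "0 < sin (pi * (?y - ?x))"
      using bounds by (intro sin_pi_times_pos; linarith)+
    moreover have "sin (pi * (?x - ?y)) = - sin (pi * (?y - ?x))"
      by (metis minus_diff_eq mult_minus_right sin_minus)
    ultimately have "?t < 0" unfolding turn_circ
      by (simp add: mult_pos_neg)
    then show ?thesis using 2 unfolding cyc_def by simp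
  next
    case 3
    then have "0 < sin (pi * ?x)" "0 < sin (pi * ?y)" "0 < sin (pi * (?x - ?y))"
      using bounds by (intro sin_pi_times_pos; linarith)+
    then have "?t > 0" unfolding turn_circ by simp
    then show ?thesis using 3 unfolding cyc_def by simp
  qed
  then show "?t < 0 \<longleftrightarrow> cyc a p b" "?t > 0 \<longleftrightarrow> cyc b p a" using rot by auto
qed

lemma norm_circ [simp]: "norm (circ t) = 1"
  by (simp add: circ_def)

text \<open>The power of a point: it shows which points of the line through \<open>A\<close> and \<open>B\<close> lie in the disk.\<close>

lemma norm_chord_point:
  fixes A B :: complex
  assumes "norm A = 1" "norm B = 1"
  shows "(norm (A + s *\<^sub>R (B - A)))\<^sup>2 = 1 - s * (1 - s) * (norm (B - A))\<^sup>2"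
proof -
  have "(norm (A + s *\<^sub>R (B - A)))\<^sup>2 = (1 - s) * (norm A)\<^sup>2 + s * (norm B)\<^sup>2 - s * (1 - s) * (norm (B - A))\<^sup>2"
    unfolding cmod_power2 by (simp add: power2_eq_square algebra_simps)
  then show ?thesis using assms by simp
qed

text \<open>If \<open>p\<close> and \<open>q\<close> lie on the same side of the line through \<open>a\<close> and \<open>b\<close>, so does
  the whole chord between them. Otherwise this chord meets the line, and it does so in the disk, hence on the
  other chord.\<close>

lemma chords_meet_iff:
  assumes "p - a \<notin> \<int>" "p - b \<notin> \<int>" "q - a \<notin> \<int>" "q - b \<notin> \<int>" "b - a \<notin> \<int>"
  shows "closed_segment (circ a) (circ b) \<inter> closed_segment (circ p) (circ q) \<noteq> {}
     \<longleftrightarrow> (cyc a p b \<longleftrightarrow> \<not> cyc a q b)"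
proof -
  define L where "L z = turn (circ b - circ a) (z - circ a)" for z
  have L_chord: "L (circ a + s *\<^sub>R (circ b - circ a)) = 0" for s
    by (simp add: L_def turn_linear)
  have L_affine: "L ((1 - r) *\<^sub>R z + r *\<^sub>R w) = (1 - r) * L z + r * L w" for r z w
    unfolding L_def by (simp add: turn_linear algebra_simps)
  have sides: "L (circ p) < 0 \<longleftrightarrow> cyc a p b" "L (circ p) > 0 \<longleftrightarrow> \<not> cyc a p b"
    "L (circ q) < 0 \<longleftrightarrow> cyc a q b" "L (circ q) > 0 \<longleftrightarrow> \<not> cyc a q b"
    using assms by (simp_all add: L_def turn_circ_neg_iff turn_circ_pos_iff cyc_total)
  show ?thesis
  proof
    assume "closed_segment (circ a) (circ b) \<inter> closed_segment (circ p) (circ q) \<noteq> {}"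
    then obtain s r where r: "0 \<le> r" "r \<le> 1"
      and eq: "(1 - s) *\<^sub>R circ a + s *\<^sub>R circ b = (1 - r) *\<^sub>R circ p + r *\<^sub>R circ q"
      by (auto simp: closed_segment_def)
    have "(1 - s) *\<^sub>R circ a + s *\<^sub>R circ b = circ a + s *\<^sub>R (circ b - circ a)"
      by (simp add: algebra_simps)
    then have zero: "(1 - r) * L (circ p) + r * L (circ q) = 0"
      using L_chord[of s] L_affine[of r "circ p" "circ q"] eq by simp
    have "\<not> (L (circ p) > 0 \<and> L (circ q) > 0)"
    proof
      assume pos: "L (circ p) > 0 \<and> L (circ q) > 0"
      then have "(1 - r) * L (circ p) \<ge> 0" "r * L (circ q) \<ge> 0" using r by simp_all
      then have "(1 - r) * L (circ p) = 0" "r * L (circ q) = 0" using zero by linarith+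
      then show False using pos by simp
    qed
    moreover have "\<not> (L (circ p) < 0 \<and> L (circ q) < 0)"
    proof
      assume neg: "L (circ p) < 0 \<and> L (circ q) < 0"
      then have "(1 - r) * L (circ p) \<le> 0" "r * L (circ q) \<le> 0"
        using r by (simp_all add: mult_nonneg_nonpos)
      then have "(1 - r) * L (circ p) = 0" "r * L (circ q) = 0" using zero by linarith+
      then show False using neg by simp
    qed
    ultimately show "cyc a p b \<longleftrightarrow> \<not> cyc a q b" using sides by blast
  next
    assume "cyc a p b \<longleftrightarrow> \<not> cyc a q b"
    then have opp: "L (circ p) < 0 \<and> L (circ q) > 0 \<or> L (circ p) > 0 \<and> L (circ q) < 0"
      using sides by blast
    define r where "r = L (circ p) / (L (circ p) - L (circ q))"
    have r: "0 \<le> r" "r \<le> 1" and r0: "(1 - r) * L (circ p) + r * L (circ q) = 0"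
      using opp by (auto simp: r_def field_simps)
    define z where "z = (1 - r) *\<^sub>R circ p + r *\<^sub>R circ q"
    have z_seg: "z \<in> closed_segment (circ p) (circ q)"
      using r by (auto simp: z_def closed_segment_def)
    have ab: "circ b - circ a \<noteq> 0"
      using opp by (auto simp: L_def turn_coords)
    have "L z = 0" using r0 by (simp add: z_def L_affine)
    then obtain s where "z - circ a = s *\<^sub>R (circ b - circ a)"
      using turn_eq_0_imp_scaleR[OF _ ab] by (auto simp: L_def)
    then have z: "z = circ a + s *\<^sub>R (circ b - circ a)" by (simp add: algebra_simps)
    have "norm z \<le> 1"
      using norm_triangle_ineq[of "(1 - r) *\<^sub>R circ p" "r *\<^sub>R circ q"] r by (simp add: z_def)
    then have "(norm z)\<^sup>2 \<le> 1" by (simp add: power_le_one)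
    then have "0 \<le> s * (1 - s) * (norm (circ b - circ a))\<^sup>2"
      by (simp add: z norm_chord_point)
    then have "0 \<le> s * (1 - s)"
      using ab by (simp add: zero_le_mult_iff)
    then have "0 \<le> s" "s \<le> 1" by (auto simp: zero_le_mult_iff)
    moreover have "z = (1 - s) *\<^sub>R circ a + s *\<^sub>R circ b" using z by (simp add: algebra_simps)
    ultimately have "z \<in> closed_segment (circ a) (circ b)" by (auto simp: closed_segment_def)
    then show "closed_segment (circ a) (circ b) \<inter> closed_segment (circ p) (circ q) \<noteq> {}"
      using z_seg by blast
  qed
qed

section \<open>Oriented smoothing of two crossings\<close>

lemma next_cut_eqI:
  assumes cut: "cut_points S = {x0, x1, x2, x3}"
    and ord: "cyc x0 x1 x2" "cyc x0 x2 x3"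
  shows "next_cut S x0 = x1"
proof -
  have less: "0 < frac (x1 - x0)" "frac (x1 - x0) < frac (x2 - x0)" "frac (x2 - x0) < frac (x3 - x0)"
    using ord by (auto simp: cyc_def)
  have ne: "x1 \<noteq> x0" using less by auto
  let ?P = "\<lambda>w. w \<in> cut_points S \<and> w \<noteq> x0"
  have "frac (next_cut S x0 - x0) = frac (x1 - x0)"
    unfolding next_cut_def
    by (rule arg_min_equality) (use cut ne less in auto)
  moreover have "?P (next_cut S x0)"
    unfolding next_cut_def
    by (rule arg_minI[where P = ?P and x = x1]) (use cut ne less in auto)
  ultimately show ?thesis
    using cut less by auto
qed

lemma cyc_trans_rotate:
  assumes "cyc x0 x1 x2" "cyc x0 x2 x3"
  shows "cyc x1 x2 x3" "cyc x1 x3 x0"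
proof -
  have c: "cyc x0 x1 x3" using assms unfolding cyc_def by linarith
  then show "cyc x1 x3 x0" using cyc_rotate by blast
  show "cyc x1 x2 x3"
    using assms cyc_offsets[OF assms(1)] cyc_offsets[OF c] unfolding cyc_def by linarith
qed

lemma partner_eqI:
  assumes "S = {(a, b), (c, d)}" "distinct [a, b, c, d]"
  shows "partner S a = b" "partner S b = a" "partner S c = d" "partner S d = c"
  using assms unfolding partner_def by (auto intro!: the_equality)

lemma orbit_fixpoint: "f x = x \<Longrightarrow> orbit f x = {x}"
proof -
  assume "f x = x"
  have "y \<in> orbit f x \<Longrightarrow> y = x" for y
    by (induction rule: orbit.induct) (use \<open>f x = x\<close> in auto)
  then show ?thesis using orbit.base[of f x] \<open>f x = x\<close> by auto
qed

lemma orbit_swapped_pair: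
  assumes "f x = y" "f y = x"
  shows "orbit f x = {x, y}"
proof -
  have "z \<in> orbit f x \<Longrightarrow> z \<in> {x, y}" for z
    by (induction rule: orbit.induct) (use assms in auto)
  moreover have "y \<in> orbit f x" using orbit.base[of f x] assms by simp
  moreover have "x \<in> orbit f x" using orbit.step[OF calculation(2)] assms by simp
  ultimately show ?thesis by auto
qed

lemma smoothing_components_quadruple:
  assumes cut: "cut_points S = {x0, x1, x2, x3}"
    and ord: "cyc x0 x1 x2" "cyc x0 x2 x3"
  shows "smoothing_components S = orbit (\<lambda>v. partner S (next_cut S v)) ` {x0, x1, x2, x3}"
    and "next_cut S x0 = x1" "next_cut S x1 = x2" "next_cut S x2 = x3" "next_cut S x3 = x0"
    and "distinct [x0, x1, x2, x3]"
proof -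
  note o1 = cyc_trans_rotate[OF ord]
  note o2 = cyc_trans_rotate[OF o1]
  note o3 = cyc_trans_rotate[OF o2]
  show "next_cut S x0 = x1" using next_cut_eqI[OF cut ord] .
  show "next_cut S x1 = x2" by (rule next_cut_eqI[OF _ o1]) (use cut in auto)
  show "next_cut S x2 = x3" by (rule next_cut_eqI[OF _ o2]) (use cut in auto)
  show "next_cut S x3 = x0" by (rule next_cut_eqI[OF _ o3]) (use cut in auto)
  show "distinct [x0, x1, x2, x3]" using ord o1 o2 o3 by auto
  show "smoothing_components S = orbit (\<lambda>v. partner S (next_cut S v)) ` {x0, x1, x2, x3}"
    by (simp add: smoothing_components_def cut)
qed

text \<open>The arc from \<open>x0\<close> to \<open>x1\<close> and the arc from \<open>x2\<close> to \<open>x3\<close> close up, and the other two arcs together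
  form the third component.\<close>

lemma card_smoothing_parallel:
  assumes S: "cut_points S = {x0, x1, x2, x3}" and ord: "cyc x0 x1 x2" "cyc x0 x2 x3"
    and partners: "partner S x0 = x1" "partner S x1 = x0" "partner S x2 = x3" "partner S x3 = x2"
  shows "card (smoothing_components S) = 3"
proof -
  note q = smoothing_components_quadruple[OF S ord]
  let ?f = "\<lambda>v. partner S (next_cut S v)"
  have f: "?f x0 = x0" "?f x1 = x3" "?f x2 = x2" "?f x3 = x1" by (simp_all add: q partners)
  have "orbit ?f x0 = {x0}" "orbit ?f x1 = {x1, x3}" "orbit ?f x2 = {x2}" "orbit ?f x3 = {x3, x1}"
    using f by (auto intro!: orbit_fixpoint orbit_swapped_pair)
  then have "smoothing_components S = {{x0}, {x1, x3}, {x2}}" unfolding q(1) by auto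
  then show ?thesis using q(6) by (auto simp: card_insert_if doubleton_eq_iff)
qed

text \<open>All four arcs form one cycle, which is run through in the reverse order of the cut points.\<close>

lemma card_smoothing_crossed:
  assumes S: "cut_points S = {x0, x1, x2, x3}" and ord: "cyc x0 x1 x2" "cyc x0 x2 x3"
    and partners: "partner S x0 = x2" "partner S x2 = x0" "partner S x1 = x3" "partner S x3 = x1"
  shows "card (smoothing_components S) \<noteq> 3"
proof -
  note q = smoothing_components_quadruple[OF S ord]
  let ?f = "\<lambda>v. partner S (next_cut S v)"
  have f: "?f x0 = x3" "?f x3 = x2" "?f x2 = x1" "?f x1 = x0" by (simp_all add: q partners)
  have x3: "x3 \<in> orbit ?f x0" using orbit.base[of ?f x0] f by simp
  have x2: "x2 \<in> orbit ?f x0" using orbit.step[OF x3] f by simp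
  have x1: "x1 \<in> orbit ?f x0" using orbit.step[OF x2] f by simp
  have x0: "x0 \<in> orbit ?f x0" using orbit.step[OF x1] f by simp
  have "orbit ?f x3 = orbit ?f x0" "orbit ?f x2 = orbit ?f x3" "orbit ?f x1 = orbit ?f x2"
    using self_in_orbit_step[of x0 ?f] self_in_orbit_step[of x3 ?f] self_in_orbit_step[of x2 ?f]
      self_in_orbit_trans[OF x0 x3] self_in_orbit_trans[OF x0 x2] f x0 by auto
  then have "smoothing_components S = {orbit ?f x0}" unfolding q(1) by auto
  then show ?thesis by simp
qed

text \<open>In two of the six cyclic orders of \<open>a, b, c, d\<close> the pairs are linked. After a rotation, the other four are
  instances of \<open>card_smoothing_parallel\<close>.\<close>

lemma card_smoothing_components_iff:
  assumes "a - b \<notin> \<int>" "c - a \<notin> \<int>" "c - b \<notin> \<int>" "d - a \<notin> \<int>" "d - b \<notin> \<int>" "c - d \<notin> \<int>"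
  shows "card (smoothing_components {(a, b), (c, d)}) = 3 \<longleftrightarrow> (cyc a c b \<longleftrightarrow> cyc a d b)"
proof -
  let ?S = "{(a, b), (c, d)}"
  have neg: "y - x \<notin> \<int>" if "x - y \<notin> \<int>" for x y :: real
    using that Ints_minus[of "y - x"] by auto
  have cut: "cut_points ?S = {a, b, c, d}" by (auto simp: cut_points_def)
  have distinct: "distinct [a, b, c, d]" using assms by auto
  note pt = partner_eqI[OF HOL.refl distinct]
  have total: "cyc a x y \<longleftrightarrow> \<not> cyc a y x" if "x - a \<notin> \<int>" "y - a \<notin> \<int>" "x - y \<notin> \<int>" for x y
    using cyc_total[of a y x] that neg cyc_rotate by metis
  have bc: "cyc a b c \<longleftrightarrow> \<not> cyc a c b" and bd: "cyc a b d \<longleftrightarrow> \<not> cyc a d b"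
    and cd: "cyc a c d \<longleftrightarrow> \<not> cyc a d c"
    using total assms neg by metis+
  have tr: "cyc a x z" if "cyc a x y" "cyc a y z" for x y z
    using that unfolding cyc_def by linarith
  consider "cyc a b c" "cyc a c d" | "cyc a b d" "cyc a d c"
    | "cyc a c d" "cyc a d b" | "cyc a d c" "cyc a c b"
    | "cyc a c b" "cyc a b d" | "cyc a d b" "cyc a b c"
    using bc bd cd by blast
  then show ?thesis
  proof cases
    case 1
    have "card (smoothing_components ?S) = 3"
      by (rule card_smoothing_parallel[OF _ 1]) (use cut pt in auto)
    then show ?thesis using 1 bc bd tr by blast
  next
    case 2
    have "card (smoothing_components ?S) = 3"
      by (rule card_smoothing_parallel[OF _ 2]) (use cut pt in auto)
    then show ?thesis using 2 bc bd tr by blast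
  next
    case 3
    have "card (smoothing_components ?S) = 3"
      by (rule card_smoothing_parallel[OF _ cyc_trans_rotate[OF 3]]) (use cut pt in auto)
    then show ?thesis using 3 bc bd tr by blast
  next
    case 4
    have "card (smoothing_components ?S) = 3"
      by (rule card_smoothing_parallel[OF _ cyc_trans_rotate[OF 4]]) (use cut pt in auto)
    then show ?thesis using 4 bc bd tr by blast
  next
    case 5
    have "card (smoothing_components ?S) \<noteq> 3"
      by (rule card_smoothing_crossed[OF _ 5]) (use cut pt in auto)
    then show ?thesis using 5 bc bd tr by blast
  next
    case 6
    have "card (smoothing_components ?S) \<noteq> 3"
      by (rule card_smoothing_crossed[OF _ 6]) (use cut pt in auto)
    then show ?thesis using 6 bc bd tr by blast
  qed
qed

section \<open>The index formula for the weight\<close>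

abbreviation classical :: "passage \<Rightarrow> bool" where
  "classical m \<equiv> m = Over \<or> m = Under"

definition endpoints :: "diagram \<Rightarrow> real set" where
  "endpoints D = {p \<in> {0..<1}. classical (mark D p)}"

text \<open>The partner \<open>q\<close> of a passage \<open>p\<close> is unique only modulo 1, hence the quantifier. With the sign conventions for crossings,
  this is minus the crossing sign at an over passage and plus the crossing sign at an under passage.\<close>

definition crossing_index :: "diagram \<Rightarrow> real \<Rightarrow> int" where
  "crossing_index D p =
     (if \<exists>q. double_point D p q \<and> turn (velocity D p) (velocity D q) > 0 then -1 else 1)"

definition arc_index :: "diagram \<Rightarrow> real \<Rightarrow> real \<Rightarrow> int" where
  "arc_index D a b = (\<Sum>p\<in>endpoints D. crossing_index D p * of_bool (cyc a p b))"

lemma opposite_opposite [simp]: "opposite (opposite m) = m"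
  by (cases m) auto

locale knot_diagram =
  fixes D :: diagram
  assumes diagram: "virtual_knot_diagram D"
begin

lemma curve_cong: "s - t \<in> \<int> \<Longrightarrow> curve D s = curve D t"
proof -
  have nat: "curve D (t + of_nat n) = curve D t" for t n
  proof (induction n)
    case (Suc n)
    have "curve D ((t + of_nat n) + 1) = curve D (t + of_nat n)"
      using diagram unfolding virtual_knot_diagram_def by blast
    then show ?case using Suc by (simp add: add_ac)
  qed simp
  assume "s - t \<in> \<int>"
  then obtain k where k: "s - t = of_int k" by (auto elim: Ints_cases)
  show ?thesis
  proof (cases "k \<ge> 0")
    case True
    then have "s = t + of_nat (nat k)" using k by simp
    then show ?thesis using nat by metis
  next
    case False
    then have "t = s + of_nat (nat (- k))" using k by simp
    then show ?thesis using nat by metis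
  qed
qed

lemma curve_derivative: "(curve D has_vector_derivative velocity D t) (at t)"
  using diagram
  unfolding virtual_knot_diagram_def velocity_def C1_differentiable_on_def
  by (metis UNIV_I vector_derivative_at)

lemma velocity_cong:
  assumes "s - t \<in> \<int>"
  shows "velocity D s = velocity D t"
proof -
  have "((curve D \<circ> (\<lambda>x. x + (t - s))) has_vector_derivative (1 *\<^sub>R velocity D (s + (t - s)))) (at s)"
    by (rule vector_diff_chain_at) (auto intro!: derivative_eq_intros curve_derivative)
  moreover have "curve D \<circ> (\<lambda>x. x + (t - s)) = curve D"
    using curve_cong assms by (auto simp: fun_eq_iff) (metis Ints_minus add_diff_cancel_left' minus_diff_eq)
  ultimately have "(curve D has_vector_derivative velocity D t) (at s)" by simp
  then show ?thesis using curve_derivative vector_derivative_unique_at by blast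
qed

lemma double_point_sym: "double_point D s t \<Longrightarrow> double_point D t s"
  unfolding double_point_def by (metis Ints_minus minus_diff_eq)

lemma double_point_cong:
  assumes "s - s' \<in> \<int>" "t - t' \<in> \<int>"
  shows "double_point D s t \<longleftrightarrow> double_point D s' t'"
proof -
  have "(s - t) - (s' - t') \<in> \<int>" using Ints_diff[OF assms] by (simp add: algebra_simps)
  then have "s - t \<in> \<int> \<longleftrightarrow> s' - t' \<in> \<int>"
    by (metis Ints_add Ints_diff diff_add_cancel diff_diff_eq2 add_diff_cancel_left')
  then show ?thesis using curve_cong assms unfolding double_point_def by metis
qed

lemma double_point_unique:
  assumes "double_point D s t" "double_point D s u"
  shows "t - u \<in> \<int>"
proof (rule ccontr)
  assume "t - u \<notin> \<int>"
  then have "double_point D t u" using assms by (simp add: double_point_def)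
  then show False using assms diagram unfolding virtual_knot_diagram_def by blast
qed

lemma mark_double_point:
  assumes "double_point D s t"
  shows "mark D s \<noteq> Simple" "mark D t = opposite (mark D s)"
    "turn (velocity D s) (velocity D t) \<noteq> 0"
  using diagram assms unfolding virtual_knot_diagram_def by blast+

lemma double_point_exists: "mark D s \<noteq> Simple \<Longrightarrow> \<exists>t. double_point D s t"
  using diagram unfolding virtual_knot_diagram_def by blast

lemma mark_cong:
  assumes "s - t \<in> \<int>"
  shows "mark D s = mark D t"
proof (cases "\<exists>u. double_point D s u")
  case True
  then obtain u where u: "double_point D s u" by blast
  then have "double_point D t u" using double_point_cong[OF assms, of u u] by simp
  then have "mark D s = opposite (mark D u)" "mark D t = opposite (mark D u)"
    using u double_point_sym mark_double_point(2) by blast+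
  then show ?thesis by simp
next
  case False
  then have "\<nexists>u. double_point D t u" using double_point_cong[OF assms] by (metis Ints_0 diff_self)
  then show ?thesis using False double_point_exists by metis
qed

lemma frac_double_point [simp]:
  "double_point D (frac s) t \<longleftrightarrow> double_point D s t"
  "double_point D s (frac t) \<longleftrightarrow> double_point D s t"
  by (rule double_point_cong; simp add: diff_frac_Ints)+

lemma frac_data [simp]:
  "curve D (frac s) = curve D s" "mark D (frac s) = mark D s" "velocity D (frac s) = velocity D s"
  by (rule curve_cong mark_cong velocity_cong; simp add: diff_frac_Ints)+

lemma arrowsI:
  assumes "double_point D s t" "mark D s = Over"
  shows "(frac s, frac t) \<in> arrows D"
  using assms mark_double_point[OF assms(1)] by (simp add: arrows_def frac_lt_1)

lemma arrowsD:
  assumes "c \<in> arrows D"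
  shows "double_point D (fst c) (snd c)" "mark D (fst c) = Over" "mark D (snd c) = Under"
    "frac (fst c) = fst c" "frac (snd c) = snd c"
  using assms by (auto simp: arrows_def)

lemma finite_arrow_set: "finite (arrows D)"
  using finite_arrows diagram by blast

lemma Ints_diff_eq:
  fixes x y :: real
  assumes "x - y \<in> \<int>" "frac x = x" "frac y = y" shows "x = y"
  using frac_cong_Ints[OF assms(1)] assms(2,3) by simp

lemma arrow_eq_if:
  assumes "c \<in> arrows D" "x \<in> arrows D"
  shows "fst c - fst x \<in> \<int> \<Longrightarrow> c = x" "snd c - snd x \<in> \<int> \<Longrightarrow> c = x" 
    "fst c - snd x \<notin> \<int>"
proof -
  note c = arrowsD[OF assms(1)] and x = arrowsD[OF assms(2)]
  show "c = x" if "fst c - fst x \<in> \<int>"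
  proof -
    have "fst c = fst x" using Ints_diff_eq that c x by blast
    then have "snd c = snd x" using Ints_diff_eq double_point_unique c x by metis
    then show ?thesis using \<open>fst c = fst x\<close> by (simp add: prod_eq_iff)
  qed
  show "c = x" if "snd c - snd x \<in> \<int>"
  proof -
    have "snd c = snd x" using Ints_diff_eq that c x by blast
    then have "fst c = fst x" using Ints_diff_eq double_point_unique double_point_sym c x by metis
    then show ?thesis using \<open>snd c = snd x\<close> by (simp add: prod_eq_iff)
  qed
  show "fst c - snd x \<notin> \<int>"
  proof
    assume "fst c - snd x \<in> \<int>"
    then show False using mark_cong c x by force
  qed
qed

lemma arrow_ends_distinct:
  assumes "c \<in> arrows D" "x \<in> arrows D" "c \<noteq> x"
  shows "fst x - fst c \<notin> \<int>" "fst x - snd c \<notin> \<int>" "snd x - fst c \<notin> \<int>" "snd x - snd c \<notin> \<int>"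
    "snd c - fst c \<notin> \<int>"
  using arrow_eq_if[OF assms(2,1)] arrow_eq_if[OF assms(1,2)] arrow_eq_if[OF assms(1,1)] assms(3)
    Ints_minus[of "snd x - fst c"] Ints_minus[of "snd c - fst c"] by auto

lemma intersects_iff:
  assumes "c \<in> arrows D" "x \<in> arrows D" "c \<noteq> x"
  shows "intersects c x \<longleftrightarrow> (cyc (fst c) (fst x) (snd c) \<longleftrightarrow> \<not> cyc (fst c) (snd x) (snd c))"
  using chords_meet_iff[of "fst x" "fst c" "snd c" "snd x"] arrow_ends_distinct[OF assms] assms(3)
  by (auto simp: intersects_def tail_def head_def circ_def)

text \<open>If \<open>c\<close> points upward, then the arc from its tail to its head is the right half of the circle. An arrow that
  intersects \<open>c\<close> goes from left to right if its head is on that arc, and from right to left if its tail is.\<close>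

lemma int_sign_eq:
  assumes "c \<in> arrows D" "x \<in> arrows D" "intersects c x"
  shows "int_sign c x = of_bool (cyc (fst c) (snd x) (snd c)) - of_bool (cyc (fst c) (fst x) (snd c))"
proof -
  have "c \<noteq> x" using assms(3) by (auto simp: intersects_def)
  note ends = arrow_ends_distinct[OF assms(1,2) this] and crossed = intersects_iff[OF assms(1,2) this]
  let ?L = "\<lambda>p. turn (circ (snd c) - circ (fst c)) (circ p - circ (fst c))"
  (* the determinant in int_sign compares the sides of the line through c on which head and tail of x lie *)
  have turn: "turn (head c - tail c) (head x - tail x) = ?L (snd x) - ?L (fst x)"
    by (simp add: head_def tail_def circ_def turn_linear)
  have "?L (snd x) < 0 \<longleftrightarrow> cyc (fst c) (snd x) (snd c)" "?L (fst x) < 0 \<longleftrightarrow> cyc (fst c) (fst x) (snd c)"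
    "?L (snd x) > 0 \<longleftrightarrow> \<not> cyc (fst c) (snd x) (snd c)" "?L (fst x) > 0 \<longleftrightarrow> \<not> cyc (fst c) (fst x) (snd c)"
    using ends by (simp_all add: turn_circ_neg_iff turn_circ_pos_iff cyc_total)
  then show ?thesis using crossed assms(3) turn unfolding int_sign_def by auto
qed

lemma crossing_index_eq:
  assumes "double_point D p q"
  shows "crossing_index D p = (if turn (velocity D p) (velocity D q) > 0 then -1 else 1)"
proof -
  have "velocity D q' = velocity D q" if "double_point D p q'" for q'
    using double_point_unique[OF that assms] velocity_cong by blast
  then show ?thesis using assms unfolding crossing_index_def by metis
qed

lemma crossing_index_arrow:
  assumes "c \<in> arrows D"
  shows "crossing_index D (fst c) = - crossing_sign D c" "crossing_index D (snd c) = crossing_sign D c"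
  using crossing_index_eq[OF arrowsD(1)[OF assms]] mark_double_point(3)[OF arrowsD(1)[OF assms]]
    crossing_index_eq[OF double_point_sym[OF arrowsD(1)[OF assms]]]
    turn_swap[of "velocity D (snd c)" "velocity D (fst c)"]
  by (auto simp: crossing_sign_def)

lemma endpoints_eq: "endpoints D = fst ` arrows D \<union> snd ` arrows D"
proof (intro equalityI subsetI)
  fix p assume p: "p \<in> endpoints D"
  then have fp: "frac p = p" by (auto simp: endpoints_def)
  obtain q where q: "double_point D p q"
    using double_point_exists[of p] p by (auto simp: endpoints_def)
  show "p \<in> fst ` arrows D \<union> snd ` arrows D"
  proof (cases "mark D p = Over")
    case True
    then show ?thesis using arrowsI[OF q] fp by force
  next
    case False
    then have "mark D q = Over" using p mark_double_point[OF q] by (auto simp: endpoints_def)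
    then show ?thesis using arrowsI[OF double_point_sym[OF q]] fp by force
  qed
qed (auto simp: endpoints_def arrows_def)

lemma finite_endpoints: "finite (endpoints D)"
  using finite_arrow_set by (simp add: endpoints_eq)

text \<open>An arrow that does not intersect \<open>c\<close> has both ends on the arc or none; as the
  indices of its ends are opposite, it may be included in the sum. Then the sum over arrows is
  rearranged into a sum over their ends.\<close>

theorem weight_eq_arc_index:
  assumes c: "c \<in> arrows D"
  shows "weight D c = arc_index D (fst c) (snd c)"
proof -
  let ?in = "\<lambda>p. of_bool (cyc (fst c) p (snd c)) :: int"
  have "weight D c = (\<Sum>x\<in>{x \<in> arrows D. intersects c x}. crossing_sign D x * (?in (snd x) - ?in (fst x)))"
    unfolding weight_def using int_sign_eq[OF c] by (intro sum.cong) auto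
  also have "\<dots> = (\<Sum>x\<in>arrows D. crossing_sign D x * (?in (snd x) - ?in (fst x)))"
  proof (rule sum.mono_neutral_left)
    show "\<forall>x\<in>arrows D - {x \<in> arrows D. intersects c x}. crossing_sign D x * (?in (snd x) - ?in (fst x)) = 0"
      using intersects_iff[OF c] by fastforce
  qed (use finite_arrow_set in auto)
  also have "\<dots> = (\<Sum>x\<in>arrows D. crossing_index D (fst x) * ?in (fst x))
      + (\<Sum>x\<in>arrows D. crossing_index D (snd x) * ?in (snd x))"
    unfolding sum.distrib[symmetric]
    by (intro sum.cong) (auto simp: crossing_index_arrow algebra_simps)
  also have "\<dots> = (\<Sum>p\<in>fst ` arrows D. crossing_index D p * ?in p)
      + (\<Sum>p\<in>snd ` arrows D. crossing_index D p * ?in p)"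
    using arrow_eq_if by (subst (1 2) sum.reindex) (auto intro!: inj_onI simp: o_def)
  also have "\<dots> = arc_index D (fst c) (snd c)"
    unfolding arc_index_def endpoints_eq
    by (rule sum.union_disjoint[symmetric]) (use finite_arrow_set arrow_eq_if(3) in fastforce)+
  finally show ?thesis .
qed

lemma even_weight_iff:
  "even (weight D c) \<longleftrightarrow> even (card {x \<in> arrows D. intersects c x})"
proof -
  have "{x \<in> {x \<in> arrows D. intersects c x}. odd (crossing_sign D x * int_sign c x)}
      = {x \<in> arrows D. intersects c x}"
    by (auto simp: crossing_sign_def int_sign_def)
  then show ?thesis unfolding weight_def using finite_arrow_set by (subst even_sum_iff) auto
qed

lemma three_loop_pair_iff:
  assumes "p \<in> arrows D" "q \<in> arrows D" "p \<noteq> q"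
  shows "{p, q} \<in> three_loop_pairs D \<longleftrightarrow> \<not> intersects p q"
proof -
  obtain a b c d where pq: "p = (a, b)" "q = (c, d)" by (metis surj_pair)
  have "card (smoothing_components {(a, b), (c, d)}) = 3 \<longleftrightarrow> (cyc a c b \<longleftrightarrow> cyc a d b)"
    using arrow_ends_distinct[OF assms] arrow_ends_distinct[OF assms(2,1)] assms(3)
      arrow_eq_if(3)[OF assms(1,1)] arrow_eq_if(3)[OF assms(2,2)] pq
    by (intro card_smoothing_components_iff) auto
  then show ?thesis
    using assms intersects_iff[OF assms] pq by (auto simp: three_loop_pairs_def)
qed

end

section \<open>The invariant as a product over the crossings\<close>

lemma (in comm_monoid) finprod_swap:
  assumes "finite A" "finite B" "\<And>i j. i \<in> A \<Longrightarrow> j \<in> B \<Longrightarrow> f i j \<in> carrier G"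
  shows "(\<Otimes>i\<in>A. \<Otimes>j\<in>B. f i j) = (\<Otimes>j\<in>B. \<Otimes>i\<in>A. f i j)"
  using assms(1,3)
proof (induction A)
  case (insert a A)
  then have *: "f a \<in> B \<rightarrow> carrier G" "(\<lambda>j. \<Otimes>i\<in>A. f i j) \<in> B \<rightarrow> carrier G"
    "(\<lambda>i. \<Otimes>j\<in>B. f i j) \<in> A \<rightarrow> carrier G"
    by (auto intro!: finprod_closed)
  have "(\<Otimes>i\<in>insert a A. \<Otimes>j\<in>B. f i j) = (\<Otimes>j\<in>B. f a j) \<otimes> (\<Otimes>j\<in>B. \<Otimes>i\<in>A. f i j)"
    using insert * by simp
  also have "\<dots> = (\<Otimes>j\<in>B. f a j \<otimes> (\<Otimes>i\<in>A. f i j))"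
    using * by (simp add: finprod_multf)
  also have "\<dots> = (\<Otimes>j\<in>B. \<Otimes>i\<in>insert a A. f i j)"
    using insert by (intro finprod_cong) (auto simp: simp_implies_def)
  finally show ?case .
qed simp

interpretation A: comm_group A_group
  by (rule comm_group_A_group)

lemma A_gen_closed [simp]: "A_gen i j \<in> carrier A_group"
  by (simp add: A_group_def A_gen_def)

lemma A_gen_self: "A_gen i i = \<one>\<^bsub>A_group\<^esub>"
  unfolding A_gen_def by (simp add: A_group_def word_class_eq_iff word_eq.unit)

lemma A_gen_compose: "A_gen i j \<otimes>\<^bsub>A_group\<^esub> A_gen j k = A_gen i k"
  using word_eq.compose[of i j k] by (simp add: A_gen_def A_mult_word_class word_class_eq_iff)

lemma A_gen_square: "A_gen i j \<otimes>\<^bsub>A_group\<^esub> A_gen i j = \<one>\<^bsub>A_group\<^esub>"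
  by (metis A_gen_compose A_gen_self A_gen_sym)

lemma A_gen_pow: "A_gen i j [^]\<^bsub>A_group\<^esub> (n :: nat) = (if even n then \<one>\<^bsub>A_group\<^esub> else A_gen i j)"
  by (induction n) (auto simp: A_gen_square)

text \<open>The exponent \<open>n - 1 - w\<close> of \<open>A\<^sub>0\<^sub>w\<close> matters only modulo 2, and it is even if \<open>n + w\<close> is odd.\<close>

definition crossing_factor :: "nat \<Rightarrow> int \<Rightarrow> word set" where
  "crossing_factor n w = (if odd (int n + w) then \<one>\<^bsub>A_group\<^esub> else A_gen 0 w)"

lemma crossing_factor_closed [simp]: "crossing_factor n w \<in> carrier A_group"
  by (simp add: crossing_factor_def)

context knot_diagram
begin

text \<open>Extending the product over the pair to all crossings allows the order of
  multiplication to be exchanged in \<open>Phi_fr_eq_product\<close>.\<close>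

lemma pair_gen_as_product:
  assumes "S \<in> three_loop_pairs D"
  shows "pair_gen D S =
    (\<Otimes>\<^bsub>A_group\<^esub> c\<in>arrows D. if c \<in> S then A_gen 0 (weight D c) else \<one>\<^bsub>A_group\<^esub>)"
proof -
  have S_sub: "S \<subseteq> arrows D" using assms by (auto simp: three_loop_pairs_def)
  obtain p q where S: "S = {p, q}" "p \<noteq> q"
    using assms by (auto simp: three_loop_pairs_def card_2_iff)
  have "(\<Otimes>\<^bsub>A_group\<^esub> c\<in>arrows D. if c \<in> S then A_gen 0 (weight D c) else \<one>\<^bsub>A_group\<^esub>)
      = (\<Otimes>\<^bsub>A_group\<^esub> c\<in>S. A_gen 0 (weight D c))"
    by (rule A.finprod_mono_neutral_cong_right) (use S_sub finite_arrow_set in auto)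
  also have "\<dots> = A_gen 0 (weight D p) \<otimes>\<^bsub>A_group\<^esub> A_gen 0 (weight D q)"
    using S by simp
  also have "\<dots> = A_gen (weight D p) (weight D q)"
    using A_gen_compose A_gen_sym by metis
  finally show ?thesis using S by (simp add: pair_gen_eq)
qed

text \<open>A crossing \<open>c\<close> forms a three loop pair with each of the \<open>n - 1\<close> other crossings except for those that intersect it,
  and the number of the latter is congruent to the weight of \<open>c\<close> modulo 2.\<close>

lemma card_noncrossing:
  assumes c: "c \<in> arrows D"
  shows "even (card {S \<in> three_loop_pairs D. c \<in> S}) \<longleftrightarrow> odd (int (card (arrows D)) + weight D c)"
proof -
  let ?X = "{q \<in> arrows D. q \<noteq> c \<and> \<not> intersects c q}" and ?Y = "{q \<in> arrows D. intersects c q}"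
  have "{S \<in> three_loop_pairs D. c \<in> S} = (\<lambda>q. {c, q}) ` ?X"
  proof (intro equalityI subsetI)
    fix S assume "S \<in> {S \<in> three_loop_pairs D. c \<in> S}"
    then have S: "S \<in> three_loop_pairs D" "c \<in> S" by auto
    then obtain p q where "S = {p, q}" "p \<noteq> q"
      by (auto simp: three_loop_pairs_def card_2_iff)
    then obtain q where q: "S = {c, q}" "q \<noteq> c" using S(2) by blast
    moreover have "q \<in> arrows D" using q S by (auto simp: three_loop_pairs_def)
    ultimately show "S \<in> (\<lambda>q. {c, q}) ` ?X" using three_loop_pair_iff[OF c, of q] S by auto
  next
    fix S assume "S \<in> (\<lambda>q. {c, q}) ` ?X"
    then show "S \<in> {S \<in> three_loop_pairs D. c \<in> S}" using three_loop_pair_iff[OF c] by auto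
  qed
  moreover have "inj_on (\<lambda>q. {c, q}) ?X" by (auto intro!: inj_onI simp: doubleton_eq_iff)
  ultimately have card: "card {S \<in> three_loop_pairs D. c \<in> S} = card ?X" by (simp add: card_image)
  have "arrows D = insert c (?X \<union> ?Y)" using c by (auto simp: intersects_def)
  moreover have "c \<notin> ?X \<union> ?Y" "?X \<inter> ?Y = {}" "finite ?X" "finite ?Y"
    using finite_arrow_set by (auto simp: intersects_def)
  ultimately have "card (arrows D) = Suc (card ?X + card ?Y)"
    by (metis (no_types, lifting) card_Un_disjoint card_insert_disjoint finite_UnI)
  then show ?thesis using card even_weight_iff[of c] by (simp add: even_add) blast
qed

theorem Phi_fr_eq_product:
  "Phi_fr D = (\<Otimes>\<^bsub>A_group\<^esub> c\<in>arrows D. crossing_factor (card (arrows D)) (weight D c))"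
proof -
  let ?P = "three_loop_pairs D" and ?X = "arrows D"
  let ?f = "\<lambda>S c. if c \<in> S then A_gen 0 (weight D c) else \<one>\<^bsub>A_group\<^esub>"
  have fin: "finite ?P" using finite_three_loop_pairs diagram by blast
  have "Phi_fr D = (\<Otimes>\<^bsub>A_group\<^esub> S\<in>?P. \<Otimes>\<^bsub>A_group\<^esub> c\<in>?X. ?f S c)"
    unfolding Phi_fr_def by (rule A.finprod_cong') (auto simp: pair_gen_as_product intro!: A.finprod_closed)
  also have "\<dots> = (\<Otimes>\<^bsub>A_group\<^esub> c\<in>?X. \<Otimes>\<^bsub>A_group\<^esub> S\<in>?P. ?f S c)"
    by (rule A.finprod_swap) (use fin finite_arrow_set in auto)
  also have "\<dots> = (\<Otimes>\<^bsub>A_group\<^esub> c\<in>?X. crossing_factor (card ?X) (weight D c))"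
  proof (rule A.finprod_cong')
    fix c assume c: "c \<in> ?X"
    have "(\<Otimes>\<^bsub>A_group\<^esub> S\<in>?P. ?f S c) = (\<Otimes>\<^bsub>A_group\<^esub> S\<in>{S \<in> ?P. c \<in> S}. A_gen 0 (weight D c))"
      by (rule A.finprod_mono_neutral_cong_right) (use fin in auto)
    also have "\<dots> = A_gen 0 (weight D c) [^]\<^bsub>A_group\<^esub> card {S \<in> ?P. c \<in> S}"
      by (rule A.finprod_const) simp
    also have "\<dots> = crossing_factor (card ?X) (weight D c)"
      using card_noncrossing[OF c] by (simp add: A_gen_pow crossing_factor_def)
    finally show "(\<Otimes>\<^bsub>A_group\<^esub> S\<in>?P. ?f S c) = crossing_factor (card ?X) (weight D c)" .
  qed auto
  finally show ?thesis .
qed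

lemma Phi_fr_closed: "Phi_fr D \<in> carrier A_group"
  unfolding Phi_fr_eq_product by (rule A.finprod_closed) auto

end

section \<open>Reparametrisations and diffeomorphisms of the plane\<close>

locale circle_map =
  fixes f :: "real \<Rightarrow> real"
  assumes mono: "s < t \<Longrightarrow> f s < f t" and period: "f (t + 1) = f t + 1" and surj: "surj f"
begin

lemma shift: "f (t + of_int n) = f t + of_int n"
proof -
  have nat: "f (t + of_nat n) = f t + of_nat n" for t n
  proof (induction n)
    case (Suc n)
    then show ?case using period[of "t + of_nat n"] by (simp add: add_ac)
  qed simp
  show ?thesis
  proof (cases "n \<ge> 0")
    case True
    then show ?thesis using nat[of t "nat n"] by simp
  next
    case False
    then show ?thesis using nat[of "t + of_int n" "nat (- n)"] by simp
  qed
qed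

lemma less_iff: "f s < f t \<longleftrightarrow> s < t"
proof (cases s t rule: linorder_cases)
  case greater
  then show ?thesis using mono[OF greater] by simp
qed (auto simp: mono)

lemma eq_iff: "f s = f t \<longleftrightarrow> s = t"
  using less_iff[of s t] less_iff[of t s] by auto

lemma diff_Ints_iff: "f s - f t \<in> \<int> \<longleftrightarrow> s - t \<in> \<int>"
proof
  assume "f s - f t \<in> \<int>"
  then obtain n where "f s - f t = of_int n" by (auto elim: Ints_cases)
  then have "f s = f (t + of_int n)" by (simp add: shift)
  then have "s = t + of_int n" by (simp add: eq_iff)
  then show "s - t \<in> \<int>" by simp
next
  assume "s - t \<in> \<int>"
  then obtain n where "s - t = of_int n" by (auto elim: Ints_cases)
  then have "s = t + of_int n" by simp
  then show "f s - f t \<in> \<int>" by (simp add: shift)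
qed

lemma cyc_map: "cyc (f a) (f p) (f b) \<longleftrightarrow> cyc a p b"
proof -
  let ?x = "frac (p - a)" and ?y = "frac (b - a)"
  have off: "frac (f q - f a) = f (a + frac (q - a)) - f a" for q
  proof (rule frac_eqI)
    have "q - (a + frac (q - a)) \<in> \<int>" by (simp add: frac_def)
    then show "f q - f a - (f (a + frac (q - a)) - f a) \<in> \<int>" by (simp add: diff_Ints_iff)
    show "0 \<le> f (a + frac (q - a)) - f a"
      using less_iff[of "a + frac (q - a)" a] frac_ge_0[of "q - a"] by (simp add: not_less[symmetric])
    have "f (a + frac (q - a)) < f (a + 1)" by (simp add: less_iff frac_lt_1)
    then show "f (a + frac (q - a)) - f a < 1" by (simp add: period)
  qed
  show ?thesis
    unfolding cyc_def off using less_iff[of a "a + ?x"] less_iff[of "a + ?x" "a + ?y"] by simp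
qed

end

text \<open>The common core of the two global moves: \<open>f\<close> transports the passages of \<open>D'\<close> to those of \<open>D\<close>, respecting their
  cyclic order, their marks and the side from which the other strand crosses. Then it also transports
  walks, hence weights.\<close>

lemma Phi_fr_relabel:
  assumes "virtual_knot_diagram D" "virtual_knot_diagram D'" "circle_map f"
    and dp: "\<And>s t. double_point D' s t \<longleftrightarrow> double_point D (f s) (f t)"
    and mark: "\<And>t. mark D' t = mark D (f t)"
    and turn: "\<And>s t. double_point D' s t \<Longrightarrow> turn (velocity D' s) (velocity D' t) > 0 \<longleftrightarrow>
                turn (velocity D (f s)) (velocity D (f t)) > 0"
  shows "Phi_fr D' = Phi_fr D"
proof -
  interpret D: knot_diagram D by unfold_locales fact
  interpret D': knot_diagram D' by unfold_locales fact
  interpret f: circle_map f by fact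
  let ?g = "\<lambda>t. frac (f t)"
  have inj: "s = t" if "?g s = ?g t" "frac s = s" "frac t = t" for s t
  proof -
    have "f s - f t \<in> \<int>" using frac_eq_imp_Ints that(1) by blast
    then show ?thesis using frac_cong_Ints[of s t] that by (simp add: f.diff_Ints_iff)
  qed
  have lift: "\<exists>s. frac s = s \<and> ?g s = p \<and> f s - p \<in> \<int>" if "frac p = p" for p
  proof -
    obtain s where s: "f s = p" using f.surj by (metis surjD)
    have "f (frac s) - p \<in> \<int>" by (simp only: s[symmetric] f.diff_Ints_iff diff_frac_Ints)
    moreover from this have "?g (frac s) = p" using frac_cong_Ints[of "f (frac s)" p] that by simp
    ultimately show ?thesis using frac_frac by blast
  qed
  have index: "crossing_index D' p = crossing_index D (?g p)" for p
  proof -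
    have "(\<exists>q. Q q) \<longleftrightarrow> (\<exists>q. Q (f q))" for Q
    proof
      assume "\<exists>q. Q q"
      then obtain q where q: "Q q" by blast
      obtain x where "q = f x" using surjD[OF f.surj] by blast
      then show "\<exists>q. Q (f q)" using q by blast
    qed blast
    from this[of "\<lambda>q. double_point D (f p) q \<and> turn (velocity D (f p)) (velocity D q) > 0"]
    show ?thesis unfolding crossing_index_def using turn by (auto simp: dp)
  qed
  have "bij_betw ?g (endpoints D') (endpoints D)"
  proof (rule bij_betwI')
    show "?g p = ?g q \<longleftrightarrow> p = q" if "p \<in> endpoints D'" "q \<in> endpoints D'" for p q
    proof -
      have "frac p = p" "frac q = q" using that by (auto simp: endpoints_def)
      then show ?thesis using inj by blast
    qed
    show "?g p \<in> endpoints D" if "p \<in> endpoints D'" for p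
      using that by (simp add: endpoints_def mark frac_lt_1)
    show "\<exists>q\<in>endpoints D'. p = ?g q" if p: "p \<in> endpoints D" for p
    proof -
      obtain s where s: "frac s = s" "?g s = p" "f s - p \<in> \<int>"
        using lift[of p] p by (auto simp: endpoints_def)
      have "s \<in> {0..<1}" using s(1) frac_ge_0[of s] frac_lt_1[of s] by simp
      then have "s \<in> endpoints D'"
        using D.mark_cong[OF s(3)] p by (simp add: endpoints_def mark)
      then show ?thesis using s(2) by blast
    qed
  qed
  then have arc: "arc_index D' a b = arc_index D (?g a) (?g b)" for a b
    unfolding arc_index_def by (subst sum.reindex_bij_betw[symmetric]) (auto simp: index f.cyc_map)
  let ?G = "\<lambda>c. (?g (fst c), ?g (snd c))"
  have bij: "bij_betw ?G (arrows D') (arrows D)"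
  proof (rule bij_betwI')
    show "?G c = ?G x \<longleftrightarrow> c = x" if "c \<in> arrows D'" "x \<in> arrows D'" for c x
    proof -
      note fr = D'.arrowsD(4,5)[OF that(1)] D'.arrowsD(4,5)[OF that(2)]
      show ?thesis
      proof
        assume "?G c = ?G x"
        then have "fst c = fst x" "snd c = snd x"
          using inj[OF _ fr(1,3)] inj[OF _ fr(2,4)] by simp_all
        then show "c = x" by (simp add: prod_eq_iff)
      qed simp
    qed
    show "?G c \<in> arrows D" if "c \<in> arrows D'" for c
      using D.arrowsI[of "f (fst c)" "f (snd c)"] D'.arrowsD[OF that] by (simp add: dp mark)
    show "\<exists>x\<in>arrows D'. c = ?G x" if c: "c \<in> arrows D" for c
    proof -
      note c' = D.arrowsD[OF c]
      obtain s t where st: "frac s = s" "?g s = fst c" "f s - fst c \<in> \<int>"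
        "frac t = t" "?g t = snd c" "f t - snd c \<in> \<int>"
        using lift[OF c'(4)] lift[OF c'(5)] by blast
      have "double_point D' s t" "mark D' s = Over"
        using D.double_point_cong[OF st(3,6)] D.mark_cong[OF st(3)] c' by (simp_all add: dp mark)
      then have "(s, t) \<in> arrows D'" using D'.arrowsI[of s t] st(1,4) by simp
      moreover have "c = ?G (s, t)" using st by (simp add: prod_eq_iff)
      ultimately show ?thesis by blast
    qed
  qed
  have card: "card (arrows D') = card (arrows D)" using bij by (rule bij_betw_same_card)
  have img: "arrows D = ?G ` arrows D'" using bij by (rule bij_betw_imp_surj_on[symmetric])
  have "Phi_fr D = (\<Otimes>\<^bsub>A_group\<^esub> c\<in>?G ` arrows D'. crossing_factor (card (arrows D)) (weight D c))"
    by (subst D.Phi_fr_eq_product) (rule arg_cong[OF img])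
  also have "\<dots> = (\<Otimes>\<^bsub>A_group\<^esub> c\<in>arrows D'. crossing_factor (card (arrows D)) (weight D (?G c)))"
    using bij by (intro A.finprod_reindex) (auto simp: bij_betw_def)
  also have "\<dots> = (\<Otimes>\<^bsub>A_group\<^esub> c\<in>arrows D'. crossing_factor (card (arrows D')) (weight D' c))"
  proof (rule A.finprod_cong')
    fix c assume c: "c \<in> arrows D'"
    then have "?G c \<in> arrows D" using img by blast
    then show "crossing_factor (card (arrows D)) (weight D (?G c)) =
        crossing_factor (card (arrows D')) (weight D' c)"
      using c by (simp add: D.weight_eq_arc_index D'.weight_eq_arc_index arc card)
  qed auto
  also have "\<dots> = Phi_fr D'" by (rule D'.Phi_fr_eq_product[symmetric])
  finally show ?thesis by (rule HOL.sym)
qed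

lemma circle_map_id: "circle_map id"
  by unfold_locales auto

lemma circle_diffeo_deriv:
  assumes "circle_diffeo f"
  shows "(f has_real_derivative deriv f t) (at t)"
proof -
  have "f differentiable (at t)"
    using assms by (simp add: circle_diffeo_def C1_differentiable_on_eq)
  then show ?thesis by (simp add: DERIV_deriv_iff_real_differentiable)
qed

lemma circle_diffeo_circle_map:
  assumes "circle_diffeo f"
  shows "circle_map f"
proof
  note d = circle_diffeo_deriv[OF assms]
  show "f s < f t" if "s < t" for s t
    by (rule DERIV_pos_imp_increasing[OF that]) (use d assms in \<open>auto simp: circle_diffeo_def\<close>)
  show period: "f (t + 1) = f t + 1" for t using assms unfolding circle_diffeo_def by blast
  have shift: "f (t + of_nat n) = f t + of_nat n" for t n
  proof (induction n)
    case (Suc n)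
    then show ?case using period[of "t + of_nat n"] by (simp add: add_ac)
  qed simp
  show "surj f"
  proof (unfold surj_def, rule allI)
    fix y
    obtain n :: nat where n: "\<bar>y - f 0\<bar> \<le> of_nat n" using real_arch_simple by blast
    have "\<exists>x\<ge>- of_nat n. x \<le> of_nat n \<and> f x = y"
      by (rule IVT) (use n shift[of 0 n] shift[of "- of_nat n" n] d in \<open>auto intro: DERIV_isCont\<close>)
    then show "\<exists>x. y = f x" by blast
  qed
qed

lemma Phi_fr_reparametrise:
  assumes "virtual_knot_diagram D" "virtual_knot_diagram \<lparr>curve = curve D \<circ> f, mark = mark D \<circ> f\<rparr>"
    and f: "circle_diffeo f"
  shows "Phi_fr \<lparr>curve = curve D \<circ> f, mark = mark D \<circ> f\<rparr> = Phi_fr D"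
proof (rule Phi_fr_relabel[OF assms(1,2) circle_diffeo_circle_map[OF f]])
  let ?D' = "\<lparr>curve = curve D \<circ> f, mark = mark D \<circ> f\<rparr>"
  interpret D: knot_diagram D by unfold_locales fact
  interpret f: circle_map f using circle_diffeo_circle_map[OF f] .
  show "double_point ?D' s t \<longleftrightarrow> double_point D (f s) (f t)" for s t
    by (simp add: double_point_def f.diff_Ints_iff)
  have pos: "deriv f t > 0" for t using f by (simp add: circle_diffeo_def)
  have d: "(f has_vector_derivative deriv f t) (at t)" for t
    using circle_diffeo_deriv[OF f] by (simp add: has_real_derivative_iff_has_vector_derivative)
  have "velocity ?D' t = deriv f t *\<^sub>R velocity D (f t)" for t
    unfolding velocity_def[of ?D']
    using vector_diff_chain_at[OF d D.curve_derivative] by (simp add: vector_derivative_at)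
  then show "turn (velocity ?D' s) (velocity ?D' t) > 0 \<longleftrightarrow>
      turn (velocity D (f s)) (velocity D (f t)) > 0" for s t
    using pos by (simp add: turn_linear zero_less_mult_iff) (meson less_asym)
qed simp

text \<open>The factor is the determinant of \<open>g\<close>.\<close>

lemma turn_linear_image:
  assumes "linear g"
  shows "turn (g v) (g w) = turn (g 1) (g \<i>) * turn v w"
proof -
  have g: "g z = Re z *\<^sub>R g 1 + Im z *\<^sub>R g \<i>" for z
  proof -
    have "z = Re z *\<^sub>R 1 + Im z *\<^sub>R \<i>" by (simp add: complex_eq_iff)
    then have "g z = g (Re z *\<^sub>R 1 + Im z *\<^sub>R \<i>)" by simp
    then show ?thesis using assms by (simp add: linear_add linear_scale)
  qed
  show ?thesis by (subst (1 2) g) (simp add: turn_coords algebra_simps)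
qed

lemma plane_diffeo_derivative:
  assumes "plane_diffeo h"
  obtains h' J where "\<And>z. (h has_derivative h' z) (at z)" "\<And>z. linear (h' z)"
    "\<And>z. J z > 0" "\<And>z v w. turn (h' z v) (h' z w) = J z * turn v w"
proof -
  obtain h' where h': "\<And>z. (h has_derivative h' z) (at z)" "\<And>z. turn (h' z 1) (h' z \<i>) > 0"
    using assms unfolding plane_diffeo_def by blast
  have lin: "linear (h' z)" for z using h'(1) has_derivative_linear by blast
  show ?thesis by (rule that[OF h'(1) lin h'(2) turn_linear_image[OF lin]])
qed

lemma has_vector_derivative_diffeo:
  assumes "(h has_derivative h') (at (g t))" "(g has_vector_derivative v) (at t)"
  shows "(h \<circ> g has_vector_derivative h' v) (at t)"
proof -
  have "(h \<circ> g has_derivative h' \<circ> (\<lambda>x. x *\<^sub>R v)) (at t)"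
    using diff_chain_at assms unfolding has_vector_derivative_def by blast
  moreover have "h' \<circ> (\<lambda>x. x *\<^sub>R v) = (\<lambda>x. x *\<^sub>R h' v)"
    using has_derivative_linear[OF assms(1)] by (auto simp: linear_scale)
  ultimately show ?thesis unfolding has_vector_derivative_def by simp
qed

lemma Phi_fr_diffeo:
  assumes "virtual_knot_diagram D" "virtual_knot_diagram \<lparr>curve = h \<circ> curve D, mark = mark D\<rparr>"
    and h: "plane_diffeo h"
  shows "Phi_fr \<lparr>curve = h \<circ> curve D, mark = mark D\<rparr> = Phi_fr D"
proof (rule Phi_fr_relabel[OF assms(1,2) circle_map_id])
  let ?D' = "\<lparr>curve = h \<circ> curve D, mark = mark D\<rparr>"
  interpret D: knot_diagram D by unfold_locales fact
  obtain h' J where h': "\<And>z. (h has_derivative h' z) (at z)" "\<And>z. J z > 0"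
    "\<And>z v w. turn (h' z v) (h' z w) = J z * turn v w"
    using plane_diffeo_derivative[OF h] by metis
  have "inj h" using h by (simp add: plane_diffeo_def bij_is_inj)
  then show dp: "double_point ?D' s t \<longleftrightarrow> double_point D (id s) (id t)" for s t
    by (auto simp: double_point_def inj_eq)
  have v: "velocity ?D' t = h' (curve D t) (velocity D t)" for t
    unfolding velocity_def[of ?D']
    using has_vector_derivative_diffeo[OF h'(1) D.curve_derivative] by (simp add: vector_derivative_at)
  show "turn (velocity ?D' s) (velocity ?D' t) > 0 \<longleftrightarrow>
      turn (velocity D (id s)) (velocity D (id t)) > 0" if "double_point ?D' s t" for s t
  proof -
    have "curve D s = curve D t" using that dp by (simp add: double_point_def)
    then show ?thesis using h'(2)[of "curve D t"] by (simp add: v h'(3) zero_less_mult_iff)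
  qed
qed simp

section \<open>Moving points of the cyclic order\<close>

text \<open>The segment lies in one fundamental domain that starts at \<open>a\<close>, and the representative of \<open>b\<close> there
  lies on one side of it.\<close>

lemma cyc_const_on_segment_le:
  assumes "p \<le> p'" and avoid: "\<And>x. x \<in> {p..p'} \<Longrightarrow> x - a \<notin> \<int> \<and> x - b \<notin> \<int>"
  shows "cyc a p b \<longleftrightarrow> cyc a p' b"
proof -
  let ?n = "of_int \<lfloor>p - a\<rfloor> :: real"
  have p: "frac (p - a) = p - a - ?n" "0 < p - a - ?n" "p - a - ?n < 1"
    using avoid[of p] assms(1) frac_gt_0_iff[of "p - a"] frac_lt_1[of "p - a"] by (auto simp: frac_def)
  have "a + ?n + 1 \<notin> {p..p'}"
  proof
    assume "a + ?n + 1 \<in> {p..p'}"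
    then have "a + ?n + 1 - a \<notin> \<int>" using avoid by blast
    then show False by (simp add: add.assoc)
  qed
  then have "p' < a + ?n + 1" using p by auto
  then have p': "frac (p' - a) = p' - a - ?n"
    using p assms(1) by (intro frac_eqI) auto
  let ?b = "a + ?n + frac (b - a)"
  have "?b \<notin> {p..p'}"
  proof
    assume "?b \<in> {p..p'}"
    then have "?b - b \<notin> \<int>" using avoid by blast
    moreover have "?b - b = of_int (\<lfloor>p - a\<rfloor> - \<lfloor>b - a\<rfloor>)" by (simp add: frac_def)
    ultimately show False by (metis Ints_of_int)
  qed
  then show ?thesis using p p' assms(1) unfolding cyc_def by auto
qed

lemma cyc_const_on_segment:
  assumes "\<And>x. x \<in> closed_segment p p' \<Longrightarrow> x - a \<notin> \<int> \<and> x - b \<notin> \<int>"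
  shows "cyc a p b \<longleftrightarrow> cyc a p' b"
proof (cases "p \<le> p'")
  case True
  then have "closed_segment p p' = {p..p'}" by (simp add: closed_segment_eq_real_ivl)
  then show ?thesis using cyc_const_on_segment_le[OF True] assms by simp
next
  case False
  then have le: "p' \<le> p" by simp
  then have "closed_segment p p' = {p'..p}" using False by (simp add: closed_segment_eq_real_ivl)
  then show ?thesis using cyc_const_on_segment_le[OF le, of a b] assms by simp
qed

text \<open>If the short way from \<open>p\<close> to \<open>x\<close> avoids \<open>b\<close>, then walking from \<open>p\<close> in the positive direction one meets \<open>x\<close> before \<open>b\<close>
  if \<open>x\<close> lies ahead of \<open>p\<close>, and after \<open>b\<close> otherwise.\<close>

lemma cyc_short_segment:
  assumes short: "\<bar>x - p\<bar> < 1" and avoid: "\<And>y. y \<in> closed_segment p x \<Longrightarrow> y - b \<notin> \<int>"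
  shows "cyc p x b \<longleftrightarrow> p < x"
proof -
  have b: "p + frac (b - p) + of_int n - b \<in> \<int>" for n
  proof -
    have "p + frac (b - p) + of_int n - b = of_int (n - \<lfloor>b - p\<rfloor>)" by (simp add: frac_def)
    then show ?thesis by (metis Ints_of_int)
  qed
  consider "p < x" | "x < p" | "x = p" by linarith
  then show ?thesis
  proof cases
    case 1
    then have x: "frac (x - p) = x - p" using short by (intro frac_eqI) auto
    have "\<not> frac (b - p) \<le> x - p"
      using avoid[of "p + frac (b - p)"] b[of 0] 1 by (auto simp: closed_segment_eq_real_ivl)
    then show ?thesis using 1 x by (simp add: cyc_def)
  next
    case 2
    then have x: "frac (x - p) = x - p + 1" using short by (intro frac_eqI) auto
    have "\<not> frac (b - p) > x - p + 1"
      using avoid[of "p + frac (b - p) - 1"] b[of "-1"] 2 frac_lt_1[of "b - p"]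
      by (auto simp: closed_segment_eq_real_ivl)
    then show ?thesis using 2 x by (simp add: cyc_def)
  qed simp
qed

section \<open>Standard pictures inside a diagram\<close>

definition picture_ends :: "picture \<Rightarrow> (nat \<times> real) set" where
  "picture_ends T = {(i, u). i < length T \<and> u \<in> {-1..1} \<and> classical (snd (T ! i) u)}"

definition picture_velocity :: "picture \<Rightarrow> nat \<Rightarrow> real \<Rightarrow> complex" where
  "picture_velocity T i u = vector_derivative (fst (T ! i)) (at u)"

text \<open>What the analysis of the disk needs to know about a picture. In the standard pictures with classical crossings
  all strands are graphs over the interval, so strands meet only at equal parameters. This lets a passage
  be given by a strand and a parameter, and a crossing by two strands and one parameter.\<close>

definition tame_picture :: "picture \<Rightarrow> bool" where
  "tame_picture T \<longleftrightarrow>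
     (\<forall>i<length T. \<forall>u\<in>{-1..1}. fst (T ! i) u \<in> unit_square) \<and>
     finite (picture_ends T) \<and>
     (\<forall>(i, u)\<in>picture_ends T. \<bar>u\<bar> < 1 \<and> fst (T ! i) differentiable (at u) \<and>
        (\<forall>j<length T. \<forall>v\<in>{-1..1}. fst (T ! j) v = fst (T ! i) u \<longrightarrow> v = u))"

definition partner_strand :: "picture \<Rightarrow> nat \<Rightarrow> real \<Rightarrow> nat \<Rightarrow> bool" where
  "partner_strand T i u j \<longleftrightarrow> j < length T \<and> j \<noteq> i \<and> fst (T ! j) u = fst (T ! i) u"

definition picture_crossings :: "picture \<Rightarrow> (nat \<times> nat \<times> real) set" where
  "picture_crossings T =
     {(i, j, u). (i, u) \<in> picture_ends T \<and> snd (T ! i) u = Over \<and> partner_strand T i u j}"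

definition strand_dir :: "(real \<times> real) list \<Rightarrow> nat \<Rightarrow> real" where
  "strand_dir Is i = snd (Is ! i) - fst (Is ! i)"

text \<open>The value of \<open>crossing_index\<close> computed from the picture: a chart preserves the sign of \<open>turn\<close>, and every strand that
  is traversed backwards reverses it.\<close>

definition picture_index :: "(real \<times> real) list \<Rightarrow> picture \<Rightarrow> nat \<Rightarrow> real \<Rightarrow> int" where
  "picture_index Is T i u =
     (if \<exists>j. partner_strand T i u j \<and>
          strand_dir Is i * strand_dir Is j * turn (picture_velocity T i u) (picture_velocity T j u) > 0
      then -1 else 1)"

definition on_strand :: "(real \<times> real) list \<Rightarrow> nat \<Rightarrow> real \<Rightarrow> real" where
  "on_strand Is i u = on_interval (Is ! i) u"

text \<open>Whether passage \<open>(k, v)\<close> is met on the walk that leaves the crossing of \<open>i\<close> and \<open>j\<close> at parameter \<open>u\<close> along strand \<open>i\<close> and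
  returns to it along strand \<open>j\<close>. For a third strand this does not depend on the positions on
  the strands, so all of them are taken at the parameter 0.\<close>

definition on_arc :: "(real \<times> real) list \<Rightarrow> nat \<Rightarrow> nat \<Rightarrow> real \<Rightarrow> nat \<Rightarrow> real \<Rightarrow> bool" where
  "on_arc Is i j u k v \<longleftrightarrow>
     (if k = i then strand_dir Is i * (v - u) > 0
      else if k = j then strand_dir Is j * (u - v) > 0
      else cyc (on_strand Is i 0) (on_strand Is k 0) (on_strand Is j 0))"

text \<open>The contribution of the passages in the disk to the weight of a crossing in the disk. It depends on the
  picture and the intervals only, so the two sides of a move can be compared without
  reference to the diagrams.\<close>

definition inner_index :: "(real \<times> real) list \<Rightarrow> picture \<Rightarrow> nat \<Rightarrow> nat \<Rightarrow> real \<Rightarrow> int" where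
  "inner_index Is T i j u =
     (\<Sum>(k, v)\<in>picture_ends T. picture_index Is T k v * of_bool (on_arc Is i j u k v))"

definition outer_index :: "diagram \<Rightarrow> complex set \<Rightarrow> real \<Rightarrow> real \<Rightarrow> int" where
  "outer_index D B a b =
     (\<Sum>p\<in>{p \<in> endpoints D. curve D p \<notin> B}. crossing_index D p * of_bool (cyc a p b))"

definition outer_arrows :: "diagram \<Rightarrow> complex set \<Rightarrow> arrow set" where
  "outer_arrows D B = {c \<in> arrows D. curve D (fst c) \<notin> B}"

definition inner_arrow :: "(real \<times> real) list \<Rightarrow> nat \<times> nat \<times> real \<Rightarrow> arrow" where
  "inner_arrow Is = (\<lambda>(i, j, u). (frac (on_strand Is i u), frac (on_strand Is j u)))"

lemma on_strand_diff: "on_strand Is i v - on_strand Is i u = strand_dir Is i * (v - u) / 2"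
  by (simp add: on_strand_def on_interval_def strand_dir_def field_simps)

lemma closed_segment_on_strand:
  assumes "x \<in> closed_segment (on_strand Is i u) (on_strand Is i v)" "u \<in> {-1..1}" "v \<in> {-1..1}"
  obtains w where "w \<in> {-1..1}" "x = on_strand Is i w"
proof -
  obtain r where r: "0 \<le> r" "r \<le> 1" "x = (1 - r) *\<^sub>R on_strand Is i u + r *\<^sub>R on_strand Is i v"
    using assms(1) by (auto simp: closed_segment_def)
  have "(1 - r) * u + r * v \<in> {-1..1}"
    using convexD[OF convex_real_interval(5)[of "-1" 1] assms(2,3), of "1 - r" r] r by simp
  moreover have "x = on_strand Is i ((1 - r) * u + r * v)"
    by (simp add: r(3) on_strand_def on_interval_def field_simps)
  ultimately show ?thesis by (rule that)
qed

locale shown_picture = knot_diagram +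
  fixes h :: "complex \<Rightarrow> complex" and Is :: "(real \<times> real) list" and T :: picture
  assumes shown: "shows_picture D h Is T" and tame: "tame_picture T"
begin

abbreviation disk :: "complex set" where "disk \<equiv> h ` unit_square"
abbreviation strand :: "nat \<Rightarrow> real \<Rightarrow> real" where "strand \<equiv> on_strand Is"
abbreviation dir :: "nat \<Rightarrow> real" where "dir \<equiv> strand_dir Is"

lemma inj_chart: "inj h"
  using shown by (simp add: shows_picture_def plane_diffeo_def bij_is_inj)

lemma strands_disjoint:
  assumes "i < length T" "j < length T" "u \<in> {-1..1}" "v \<in> {-1..1}" "strand i u - strand j v \<in> \<int>"
  shows "i = j \<and> u = v"
  using shown assms unfolding shows_picture_def on_strand_def by blast

lemma strand_data:
  assumes "i < length T" "u \<in> {-1..1}"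
  shows "curve D (strand i u) = h (fst (T ! i) u)" "mark D (strand i u) = snd (T ! i) u"
  using shown assms unfolding shows_picture_def on_strand_def by blast+

lemma curve_in_disk:
  assumes "curve D t \<in> disk"
  obtains i u where "i < length T" "u \<in> {-1..1}" "t - strand i u \<in> \<int>"
  using shown assms unfolding shows_picture_def on_strand_def by blast

lemma strand_in_disk: "i < length T \<Longrightarrow> u \<in> {-1..1} \<Longrightarrow> curve D (strand i u) \<in> disk"
  using tame by (simp add: strand_data tame_picture_def)

lemma outside_avoids_strand:
  assumes "curve D t \<notin> disk" "i < length T" "u \<in> {-1..1}"
  shows "strand i u - t \<notin> \<int>"
proof
  assume "strand i u - t \<in> \<int>"
  then have "curve D t = curve D (strand i u)" by (simp only: curve_cong)
  then show False using strand_in_disk[OF assms(2,3)] assms(1) by argo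
qed

lemma picture_endD:
  assumes "(i, u) \<in> picture_ends T"
  shows "i < length T" "u \<in> {-1..1}" "-1 < u" "u < 1" "fst (T ! i) differentiable (at u)"
    "classical (snd (T ! i) u)"
    "\<And>j v. j < length T \<Longrightarrow> v \<in> {-1..1} \<Longrightarrow> fst (T ! j) v = fst (T ! i) u \<Longrightarrow> v = u"
proof -
  show i: "i < length T" "u \<in> {-1..1}" "classical (snd (T ! i) u)"
    using assms by (auto simp: picture_ends_def)
  have "\<bar>u\<bar> < 1 \<and> fst (T ! i) differentiable (at u) \<and>
        (\<forall>j<length T. \<forall>v\<in>{-1..1}. fst (T ! j) v = fst (T ! i) u \<longrightarrow> v = u)"
    using tame assms unfolding tame_picture_def by fast
  then show "-1 < u" "u < 1" "fst (T ! i) differentiable (at u)"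
    "\<And>j v. j < length T \<Longrightarrow> v \<in> {-1..1} \<Longrightarrow> fst (T ! j) v = fst (T ! i) u \<Longrightarrow> v = u"
    by auto
qed

lemma finite_picture_ends: "finite (picture_ends T)"
  using tame by (simp add: tame_picture_def)

text \<open>If the interval of a strand had length 0 or at least 1, then two positions on the strand would be the same point
  of the circle.\<close>

lemma dir_bounds:
  assumes "i < length T" shows "dir i \<noteq> 0" "\<bar>dir i\<bar> < 1"
proof -
  show nz: "dir i \<noteq> 0"
    using strands_disjoint[OF assms assms, of 1 "-1"] on_strand_diff[of Is i 1 "-1"] by auto
  show "\<bar>dir i\<bar> < 1"
  proof (rule ccontr)
    assume big: "\<not> \<bar>dir i\<bar> < 1"
    (* the parameter that is one full turn away from the start of the strand *)
    define v where "v = -1 + 2 / \<bar>dir i\<bar>"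
    have v: "v \<in> {-1..1}" "v \<noteq> -1" using big by (auto simp: v_def field_simps)
    have "strand i v - strand i (-1) = dir i / \<bar>dir i\<bar>"
      unfolding on_strand_diff by (simp add: v_def)
    moreover have "dir i / \<bar>dir i\<bar> \<in> \<int>" using nz by (simp add: abs_if)
    ultimately show False using strands_disjoint[OF assms assms v(1), of "-1"] v(2) by auto
  qed
qed

lemma double_point_strand_iff:
  assumes e: "(i, u) \<in> picture_ends T"
  shows "double_point D (strand i u) q \<longleftrightarrow> (\<exists>j. partner_strand T i u j \<and> q - strand j u \<in> \<int>)"
proof
  note e' = picture_endD[OF e]
  assume dp: "double_point D (strand i u) q"
  then have eq: "curve D q = curve D (strand i u)" by (simp add: double_point_def)
  then have "curve D q \<in> disk" using strand_in_disk e' by simp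
  then obtain j v where j: "j < length T" "v \<in> {-1..1}" "q - strand j v \<in> \<int>"
    by (rule curve_in_disk)
  then have "h (fst (T ! j) v) = h (fst (T ! i) u)"
    using eq curve_cong[OF j(3)] strand_data e' by simp
  then have meet: "fst (T ! j) v = fst (T ! i) u" using inj_chart by (simp add: inj_eq)
  then have v: "v = u" using e'(7) j by blast
  have "j \<noteq> i"
  proof
    assume "j = i"
    then have "strand i u - q \<in> \<int>" using Ints_minus[OF j(3)] v by simp
    then show False using dp by (simp add: double_point_def)
  qed
  then show "\<exists>j. partner_strand T i u j \<and> q - strand j u \<in> \<int>"
    using j v meet by (auto simp: partner_strand_def)
next
  note e' = picture_endD[OF e]
  assume "\<exists>j. partner_strand T i u j \<and> q - strand j u \<in> \<int>"
  then obtain j where j: "partner_strand T i u j" "q - strand j u \<in> \<int>" by blast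
  then have "double_point D (strand i u) (strand j u)"
    using strands_disjoint[OF e'(1) _ e'(2) e'(2), of j] strand_data e'
    by (auto simp: double_point_def partner_strand_def)
  then show "double_point D (strand i u) q"
    using double_point_cong[of "strand i u" "strand i u" q "strand j u"] j by simp
qed

lemma partner_end:
  assumes "(i, u) \<in> picture_ends T" "partner_strand T i u j"
  shows "(j, u) \<in> picture_ends T" "j < length T" "j \<noteq> i"
    "double_point D (strand i u) (strand j u)" "snd (T ! j) u = opposite (snd (T ! i) u)"
proof -
  note e' = picture_endD[OF assms(1)]
  show j: "j < length T" "j \<noteq> i" using assms(2) by (auto simp: partner_strand_def)
  show dp: "double_point D (strand i u) (strand j u)"
    using double_point_strand_iff[OF assms(1)] assms(2) by auto
  show "snd (T ! j) u = opposite (snd (T ! i) u)"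
    using mark_double_point(2)[OF dp] strand_data e' j by simp
  then show "(j, u) \<in> picture_ends T" using j e' by (auto simp: picture_ends_def)
qed

text \<open>The curve along the strand equals the chart applied to the picture, on the open interval of parameters.
  So both have the same derivative.\<close>

lemma strand_velocity:
  assumes "(i, u) \<in> picture_ends T" and h': "(h has_derivative h') (at (fst (T ! i) u))"
  shows "h' (picture_velocity T i u) = (dir i / 2) *\<^sub>R velocity D (strand i u)"
proof -
  note e' = picture_endD[OF assms(1)]
  have "(on_strand Is i has_vector_derivative dir i / 2) (at u)"
    unfolding on_strand_def[abs_def] on_interval_def strand_dir_def
    by (auto intro!: derivative_eq_intros simp: has_real_derivative_iff_has_vector_derivative[symmetric] field_simps)
  then have "(curve D \<circ> strand i has_vector_derivative (dir i / 2) *\<^sub>R velocity D (strand i u)) (at u)"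
    by (rule vector_diff_chain_at[OF _ curve_derivative])
  then have "(h \<circ> fst (T ! i) has_vector_derivative (dir i / 2) *\<^sub>R velocity D (strand i u)) (at u)"
    by (rule has_vector_derivative_transform_within_open[where S = "{-1<..<1}"])
       (use e' strand_data in auto)
  moreover have "(fst (T ! i) has_vector_derivative picture_velocity T i u) (at u)"
    unfolding picture_velocity_def using e'(5) vector_derivative_works by blast
  then have "(h \<circ> fst (T ! i) has_vector_derivative h' (picture_velocity T i u)) (at u)"
    by (rule has_vector_derivative_diffeo[where g = "fst (T ! i)", OF h'])
  ultimately show ?thesis by (rule vector_derivative_unique_at[symmetric])
qed

lemma turn_strand_pos_iff:
  assumes "(i, u) \<in> picture_ends T" "partner_strand T i u j"
  shows "turn (velocity D (strand i u)) (velocity D (strand j u)) > 0 \<longleftrightarrow>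
    dir i * dir j * turn (picture_velocity T i u) (picture_velocity T j u) > 0"
proof -
  obtain h' J where h': "\<And>z. (h has_derivative h' z) (at z)" "\<And>z. J z > 0"
    "\<And>z v w. turn (h' z v) (h' z w) = J z * turn v w"
    using shown plane_diffeo_derivative[of h] unfolding shows_picture_def by metis
  let ?z = "fst (T ! i) u" and ?t = "turn (velocity D (strand i u)) (velocity D (strand j u))"
  have z: "fst (T ! j) u = ?z" using assms(2) by (simp add: partner_strand_def)
  have "J ?z * turn (picture_velocity T i u) (picture_velocity T j u) = (dir i / 2) * ((dir j / 2) * ?t)"
    unfolding h'(3)[symmetric] strand_velocity[OF assms(1) h'(1)]
      strand_velocity[OF partner_end(1)[OF assms] h'(1), unfolded z]
    by (simp add: turn_linear)
  then have "4 * J ?z * (dir i * dir j * turn (picture_velocity T i u) (picture_velocity T j u))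
      = (dir i * dir j)\<^sup>2 * ?t"
    by (simp add: power2_eq_square algebra_simps)
  moreover have "(dir i * dir j)\<^sup>2 > 0"
    using dir_bounds picture_endD(1)[OF assms(1)] partner_end(2)[OF assms] by simp
  ultimately show ?thesis
    using h'(2)[of ?z] by (metis mult_pos_pos zero_less_mult_pos zero_less_numeral)
qed

lemma crossing_index_strand:
  assumes e: "(i, u) \<in> picture_ends T"
  shows "crossing_index D (frac (strand i u)) = picture_index Is T i u"
proof -
  have "(\<exists>q. double_point D (strand i u) q \<and> turn (velocity D (strand i u)) (velocity D q) > 0)
    \<longleftrightarrow> (\<exists>j. partner_strand T i u j \<and> turn (velocity D (strand i u)) (velocity D (strand j u)) > 0)"
    (is "?L \<longleftrightarrow> ?R")
  proof
    assume ?L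
    then obtain q j where "turn (velocity D (strand i u)) (velocity D q) > 0"
      "partner_strand T i u j" "q - strand j u \<in> \<int>"
      using double_point_strand_iff[OF e] by blast
    then show ?R using velocity_cong[of q "strand j u"] by auto
  next
    assume ?R
    then show ?L using partner_end(4)[OF e] by blast
  qed
  also have "\<dots> \<longleftrightarrow> (\<exists>j. partner_strand T i u j \<and>
      dir i * dir j * turn (picture_velocity T i u) (picture_velocity T j u) > 0)"
    using turn_strand_pos_iff[OF e] by blast
  finally show ?thesis by (simp add: crossing_index_def picture_index_def)
qed

lemma strand_ends_inj: "inj_on (\<lambda>(i, u). frac (strand i u)) (picture_ends T)"
proof (rule inj_onI, clarify)
  fix i u j v
  assume e: "(i, u) \<in> picture_ends T" "(j, v) \<in> picture_ends T" "frac (strand i u) = frac (strand j v)"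
  note e1 = picture_endD(1,2)[OF e(1)] and e2 = picture_endD(1,2)[OF e(2)]
  show "i = j \<and> u = v"
    by (rule strands_disjoint[OF e1(1) e2(1) e1(2) e2(2) frac_eq_imp_Ints[OF e(3)]])
qed

lemma endpoints_split:
  "endpoints D = {p \<in> endpoints D. curve D p \<notin> disk} \<union> (\<lambda>(i, u). frac (strand i u)) ` picture_ends T"
proof (intro equalityI subsetI)
  fix p assume p: "p \<in> endpoints D"
  show "p \<in> {p \<in> endpoints D. curve D p \<notin> disk} \<union> (\<lambda>(i, u). frac (strand i u)) ` picture_ends T"
  proof (cases "curve D p \<in> disk")
    case True
    then obtain i u where iu: "i < length T" "u \<in> {-1..1}" "p - strand i u \<in> \<int>"
      by (rule curve_in_disk)
    then have "(i, u) \<in> picture_ends T"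
      using p mark_cong[OF iu(3)] strand_data by (auto simp: picture_ends_def endpoints_def)
    moreover have "p = frac (strand i u)"
      using frac_cong_Ints[OF iu(3)] p by (simp add: endpoints_def)
    ultimately show ?thesis by force
  qed (use p in blast)
next
  fix p assume "p \<in> {p \<in> endpoints D. curve D p \<notin> disk} \<union> (\<lambda>(i, u). frac (strand i u)) ` picture_ends T"
  then show "p \<in> endpoints D"
  proof
    assume "p \<in> (\<lambda>(i, u). frac (strand i u)) ` picture_ends T"
    then obtain e where "e \<in> picture_ends T" "p = (\<lambda>(i, u). frac (strand i u)) e" by blast
    then obtain i u where e: "(i, u) \<in> picture_ends T" "p = frac (strand i u)" by (cases e) auto
    show ?thesis
      using picture_endD(6)[OF e(1)] strand_data(2)[OF picture_endD(1,2)[OF e(1)]]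
      by (simp add: endpoints_def frac_lt_1 e(2))
  qed blast
qed

lemma arc_index_split:
  "arc_index D a b = outer_index D disk a b +
     (\<Sum>(k, v)\<in>picture_ends T. picture_index Is T k v * of_bool (cyc a (strand k v) b))"
proof -
  let ?f = "\<lambda>p. crossing_index D p * of_bool (cyc a p b)" and ?E = "\<lambda>(i, u). frac (strand i u)"
  have "arc_index D a b = (\<Sum>p\<in>{p \<in> endpoints D. curve D p \<notin> disk} \<union> ?E ` picture_ends T. ?f p)"
    unfolding arc_index_def by (subst endpoints_split) (rule HOL.refl)
  also have "\<dots> = outer_index D disk a b + (\<Sum>p\<in>?E ` picture_ends T. ?f p)"
    unfolding outer_index_def
  proof (rule sum.union_disjoint)
    have "curve D p \<in> disk" if p: "p \<in> ?E ` picture_ends T" for p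
    proof -
      obtain e where "p = ?E e" "e \<in> picture_ends T" using p by (rule imageE)
      then obtain i u where "(i, u) \<in> picture_ends T" "p = frac (strand i u)" by (cases e) auto
      then show ?thesis using strand_in_disk[OF picture_endD(1,2)] by simp
    qed
    then show "{p \<in> endpoints D. curve D p \<notin> disk} \<inter> ?E ` picture_ends T = {}" by blast
  qed (use finite_endpoints finite_picture_ends in simp_all)
  also have "(\<Sum>p\<in>?E ` picture_ends T. ?f p) =
      (\<Sum>(k, v)\<in>picture_ends T. picture_index Is T k v * of_bool (cyc a (strand k v) b))"
    unfolding sum.reindex[OF strand_ends_inj]
    by (rule sum.cong) (auto simp: crossing_index_strand)
  finally show ?thesis .
qed

text \<open>A walk between points outside of the disk runs through a strand completely or not at all.\<close>

lemma arc_index_outside: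
  assumes "curve D a \<notin> disk" "curve D b \<notin> disk"
  shows "arc_index D a b = outer_index D disk a b +
     (\<Sum>(k, v)\<in>picture_ends T. picture_index Is T k v * of_bool (cyc a (strand k 0) b))"
proof -
  have "cyc a (strand k v) b \<longleftrightarrow> cyc a (strand k 0) b" if e: "(k, v) \<in> picture_ends T" for k v
  proof (rule cyc_const_on_segment)
    note e' = picture_endD[OF e]
    fix x assume x: "x \<in> closed_segment (strand k v) (strand k 0)"
    obtain w where "w \<in> {-1..1}" "x = strand k w"
      by (rule closed_segment_on_strand[OF x e'(2)]) auto
    then show "x - a \<notin> \<int> \<and> x - b \<notin> \<int>" using outside_avoids_strand assms e'(1) by blast
  qed
  then show ?thesis unfolding arc_index_split by (auto intro!: sum.cong)
qed

lemma cyc_move_on_strand: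
  assumes "i < length T" "u \<in> {-1..1}" "v \<in> {-1..1}"
    and "\<And>w. w \<in> {-1..1} \<Longrightarrow> strand i w - a \<notin> \<int> \<and> strand i w - b \<notin> \<int>"
  shows "cyc a (strand i u) b \<longleftrightarrow> cyc a (strand i v) b"
proof (rule cyc_const_on_segment)
  fix x assume x: "x \<in> closed_segment (strand i u) (strand i v)"
  obtain w where "w \<in> {-1..1}" "x = strand i w"
    by (rule closed_segment_on_strand[OF x assms(2,3)])
  then show "x - a \<notin> \<int> \<and> x - b \<notin> \<int>" using assms(4) by blast
qed

text \<open>Move the two ends of the walk, one at a time, to the middle of their strands. The cyclic order is
  rotated so that the moving point is in the second position.\<close>

lemma cyc_strands:
  assumes ij: "i < length T" "j < length T" "i \<noteq> j" and u: "u \<in> {-1..1}"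
    and p: "\<And>w. w \<in> {-1..1} \<Longrightarrow> strand i w - p \<notin> \<int> \<and> strand j w - p \<notin> \<int>"
  shows "cyc (strand i u) p (strand j u) \<longleftrightarrow> cyc (strand i 0) p (strand j 0)"
proof -
  have apart: "strand i v - strand j w \<notin> \<int>" "strand j w - strand i v \<notin> \<int>"
    if "v \<in> {-1..1}" "w \<in> {-1..1}" for v w
    using strands_disjoint[OF ij(1,2) that] strands_disjoint[OF ij(2,1) that(2,1)] ij(3) by auto
  have "cyc (strand i u) p (strand j u) \<longleftrightarrow> cyc (strand j u) (strand i u) p"
    by (rule cyc_rotate[symmetric])
  also have "\<dots> \<longleftrightarrow> cyc (strand j u) (strand i 0) p"
    by (rule cyc_move_on_strand) (use ij u p apart in auto)
  also have "\<dots> \<longleftrightarrow> cyc p (strand j u) (strand i 0)"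
    by (rule cyc_rotate[symmetric])
  also have "\<dots> \<longleftrightarrow> cyc p (strand j 0) (strand i 0)"
    by (rule cyc_move_on_strand) (use ij u p apart in auto)
  also have "\<dots> \<longleftrightarrow> cyc (strand i 0) p (strand j 0)"
    by (rule cyc_rotate[symmetric])
  finally show ?thesis .
qed

lemma cyc_on_strand:
  assumes ij: "i < length T" "j < length T" "i \<noteq> j" and u: "u \<in> {-1..1}" "v \<in> {-1..1}" "w \<in> {-1..1}"
  shows "cyc (strand i u) (strand i v) (strand j w) \<longleftrightarrow> dir i * (v - u) > 0"
proof -
  have "cyc (strand i u) (strand i v) (strand j w) \<longleftrightarrow> strand i u < strand i v"
  proof (rule cyc_short_segment)
    have "\<bar>strand i v - strand i u\<bar> = \<bar>dir i\<bar> * (\<bar>v - u\<bar> / 2)"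
      by (simp add: on_strand_diff abs_mult)
    also have "\<dots> \<le> \<bar>dir i\<bar> * 1" by (rule mult_left_mono) (use u in auto)
    also have "\<dots> < 1" using dir_bounds(2)[OF ij(1)] by simp
    finally show "\<bar>strand i v - strand i u\<bar> < 1" .
    fix y assume y: "y \<in> closed_segment (strand i u) (strand i v)"
    obtain x where "x \<in> {-1..1}" "y = strand i x"
      by (rule closed_segment_on_strand[OF y u(1,2)])
    then show "y - strand j w \<notin> \<int>" using strands_disjoint[OF ij(1,2) _ u(3)] ij(3) by blast
  qed
  then show ?thesis using on_strand_diff[of Is i v u] by linarith
qed

lemma on_arc_iff:
  assumes ij: "i < length T" "j < length T" "i \<noteq> j" and u: "u \<in> {-1..1}" and e: "(k, v) \<in> picture_ends T"
  shows "cyc (strand i u) (strand k v) (strand j u) \<longleftrightarrow> on_arc Is i j u k v"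
proof -
  note e' = picture_endD[OF e]
  consider "k = i" | "k = j" | "k \<noteq> i" "k \<noteq> j" by blast
  then show ?thesis
  proof cases
    case 1
    then show ?thesis using cyc_on_strand[OF ij u e'(2) u] by (simp add: on_arc_def)
  next
    case 2
    have "cyc (strand i u) (strand j v) (strand j u) \<longleftrightarrow> cyc (strand j v) (strand j u) (strand i u)"
      by (rule cyc_rotate)
    also have "\<dots> \<longleftrightarrow> dir j * (u - v) > 0"
      by (rule cyc_on_strand) (use ij u e' in auto)
    finally show ?thesis using 2 ij by (simp add: on_arc_def)
  next
    case 3
    have apart: "strand m w - strand k x \<notin> \<int>" "strand k x - strand m w \<notin> \<int>"
      if "m < length T" "m \<noteq> k" "w \<in> {-1..1}" "x \<in> {-1..1}" for m w x
      using strands_disjoint[OF that(1) e'(1) that(3,4)] strands_disjoint[OF e'(1) that(1) that(4,3)]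
        that(2) by auto
    have "cyc (strand i u) (strand k v) (strand j u) \<longleftrightarrow> cyc (strand i 0) (strand k v) (strand j 0)"
      by (rule cyc_strands) (use ij u apart 3 e' in auto)
    also have "\<dots> \<longleftrightarrow> cyc (strand i 0) (strand k 0) (strand j 0)"
      by (rule cyc_move_on_strand) (use ij u apart 3 e' in auto)
    finally show ?thesis using 3 by (simp add: on_arc_def)
  qed
qed

lemma inner_crossingD:
  assumes "(i, j, u) \<in> picture_crossings T"
  shows "(i, u) \<in> picture_ends T" "partner_strand T i u j" "snd (T ! i) u = Over"
    "inner_arrow Is (i, j, u) \<in> arrows D"
proof -
  show e: "(i, u) \<in> picture_ends T" "partner_strand T i u j" "snd (T ! i) u = Over"
    using assms by (auto simp: picture_crossings_def)
  show "inner_arrow Is (i, j, u) \<in> arrows D"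
    using arrowsI[OF partner_end(4)[OF e(1,2)]] e(3) strand_data picture_endD[OF e(1)]
    by (simp add: inner_arrow_def)
qed

lemma weight_outer:
  assumes "c \<in> outer_arrows D disk"
  shows "weight D c = outer_index D disk (fst c) (snd c) +
     (\<Sum>(k, v)\<in>picture_ends T. picture_index Is T k v * of_bool (cyc (fst c) (strand k 0) (snd c)))"
proof -
  have c: "c \<in> arrows D" "curve D (fst c) \<notin> disk" using assms by (auto simp: outer_arrows_def)
  then have "curve D (snd c) \<notin> disk" using arrowsD(1)[OF c(1)] by (simp add: double_point_def)
  then show ?thesis using arc_index_outside c by (simp add: weight_eq_arc_index)
qed

lemma weight_inner:
  assumes x: "(i, j, u) \<in> picture_crossings T"
  shows "weight D (inner_arrow Is (i, j, u)) =
    outer_index D disk (strand i 0) (strand j 0) + inner_index Is T i j u"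
proof -
  note e = inner_crossingD[OF x]
  note e' = picture_endD[OF e(1)] and q = partner_end[OF e(1,2)]
  have "weight D (inner_arrow Is (i, j, u)) = arc_index D (strand i u) (strand j u)"
    unfolding weight_eq_arc_index[OF e(4)] by (simp add: inner_arrow_def arc_index_def)
  also have "\<dots> = outer_index D disk (strand i u) (strand j u) + inner_index Is T i j u"
    unfolding arc_index_split inner_index_def
    using on_arc_iff[OF e'(1) q(2) q(3)[symmetric] e'(2)] by (auto intro!: sum.cong)
  also have "outer_index D disk (strand i u) (strand j u) = outer_index D disk (strand i 0) (strand j 0)"
  proof -
    have "cyc (strand i u) p (strand j u) \<longleftrightarrow> cyc (strand i 0) p (strand j 0)" if "curve D p \<notin> disk" for p
      by (rule cyc_strands) (use outside_avoids_strand[OF that] e' q in auto)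
    then show ?thesis unfolding outer_index_def by (auto intro!: sum.cong)
  qed
  finally show ?thesis .
qed

lemma inner_arrow_inj: "inj_on (inner_arrow Is) (picture_crossings T)"
proof (rule inj_onI)
  fix x y assume xy: "x \<in> picture_crossings T" "y \<in> picture_crossings T" "inner_arrow Is x = inner_arrow Is y"
  obtain i j u i' j' u' where def: "x = (i, j, u)" "y = (i', j', u')" by (metis prod_cases3)
  note x = xy(1,2)[unfolded def] and eq = xy(3)[unfolded def]
  note e = inner_crossingD[OF x(1)] and e' = inner_crossingD[OF x(2)]
  have "i = i' \<and> u = u'"
    by (rule strands_disjoint)
       (use eq picture_endD[OF e(1)] picture_endD[OF e'(1)] in \<open>auto simp: inner_arrow_def intro: frac_eq_imp_Ints\<close>)
  moreover have "j = j' \<and> u = u'"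
    by (rule strands_disjoint)
       (use eq picture_endD[OF e(1)] picture_endD[OF e'(1)] partner_end(2)[OF e(1,2)] partner_end(2)[OF e'(1,2)]
        in \<open>auto simp: inner_arrow_def intro: frac_eq_imp_Ints\<close>)
  ultimately show "x = y" by (simp add: def)
qed

lemma arrows_split:
  "arrows D = outer_arrows D disk \<union> inner_arrow Is ` picture_crossings T"
  "outer_arrows D disk \<inter> inner_arrow Is ` picture_crossings T = {}"
proof -
  show "outer_arrows D disk \<inter> inner_arrow Is ` picture_crossings T = {}"
  proof -
    have "curve D (fst c) \<in> disk" if c: "c \<in> inner_arrow Is ` picture_crossings T" for c
    proof -
      obtain i j u where "(i, j, u) \<in> picture_crossings T" "c = inner_arrow Is (i, j, u)"
        using c by auto
      then show ?thesis
        using strand_in_disk[OF picture_endD(1,2)[OF inner_crossingD(1)]] by (simp add: inner_arrow_def)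
    qed
    then show ?thesis by (auto simp: outer_arrows_def)
  qed
  show "arrows D = outer_arrows D disk \<union> inner_arrow Is ` picture_crossings T"
  proof (intro equalityI subsetI)
    fix c assume c: "c \<in> arrows D"
    note c' = arrowsD[OF c]
    show "c \<in> outer_arrows D disk \<union> inner_arrow Is ` picture_crossings T"
    proof (cases "curve D (fst c) \<in> disk")
      case True
      then obtain i u where iu: "i < length T" "u \<in> {-1..1}" "fst c - strand i u \<in> \<int>"
        by (rule curve_in_disk)
      have over: "snd (T ! i) u = Over" using mark_cong[OF iu(3)] c'(2) strand_data iu by simp
      then have e: "(i, u) \<in> picture_ends T" using iu by (simp add: picture_ends_def)
      have "double_point D (strand i u) (snd c)"
        using double_point_cong[OF iu(3), of "snd c" "snd c"] c'(1) by simp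
      then obtain j where j: "partner_strand T i u j" "snd c - strand j u \<in> \<int>"
        using double_point_strand_iff[OF e] by blast
      have "c = inner_arrow Is (i, j, u)"
        using frac_cong_Ints[OF iu(3)] frac_cong_Ints[OF j(2)] c'(4,5)
        by (simp add: inner_arrow_def prod_eq_iff)
      moreover have "(i, j, u) \<in> picture_crossings T"
        using e over j by (simp add: picture_crossings_def)
      ultimately show ?thesis by blast
    qed (use c in \<open>simp add: outer_arrows_def\<close>)
  next
    fix c assume "c \<in> outer_arrows D disk \<union> inner_arrow Is ` picture_crossings T"
    then show "c \<in> arrows D" using inner_crossingD(4) by (auto simp: outer_arrows_def)
  qed
qed

lemma finite_crossings: "finite (outer_arrows D disk)" "finite (picture_crossings T)"
proof -
  have fin: "finite (outer_arrows D disk \<union> inner_arrow Is ` picture_crossings T)"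
    using finite_arrow_set by (simp only: arrows_split(1)[symmetric])
  then show "finite (outer_arrows D disk)" by blast
  from fin show "finite (picture_crossings T)" using finite_imageD[OF _ inner_arrow_inj] by blast
qed

lemma card_arrows_split: "card (arrows D) = card (outer_arrows D disk) + card (picture_crossings T)"
  using arrows_split finite_crossings inner_arrow_inj by (simp add: card_Un_disjoint card_image)

lemma Phi_fr_split:
  "Phi_fr D =
     (\<Otimes>\<^bsub>A_group\<^esub> c\<in>outer_arrows D disk. crossing_factor (card (arrows D)) (weight D c)) \<otimes>\<^bsub>A_group\<^esub>
     (\<Otimes>\<^bsub>A_group\<^esub> x\<in>picture_crossings T. crossing_factor (card (arrows D)) (weight D (inner_arrow Is x)))"
proof -
  let ?F = "\<lambda>c. crossing_factor (card (arrows D)) (weight D c)"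
  have "Phi_fr D = (\<Otimes>\<^bsub>A_group\<^esub> c\<in>outer_arrows D disk \<union> inner_arrow Is ` picture_crossings T. ?F c)"
    by (subst Phi_fr_eq_product) (rule arg_cong[OF arrows_split(1)])
  also have "\<dots> = (\<Otimes>\<^bsub>A_group\<^esub> c\<in>outer_arrows D disk. ?F c) \<otimes>\<^bsub>A_group\<^esub>
      (\<Otimes>\<^bsub>A_group\<^esub> c\<in>inner_arrow Is ` picture_crossings T. ?F c)"
    by (rule A.finprod_Un_disjoint) (use finite_crossings arrows_split(2) in auto)
  also have "(\<Otimes>\<^bsub>A_group\<^esub> c\<in>inner_arrow Is ` picture_crossings T. ?F c) =
      (\<Otimes>\<^bsub>A_group\<^esub> x\<in>picture_crossings T. ?F (inner_arrow Is x))"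
    by (rule A.finprod_reindex) (use inner_arrow_inj in auto)
  finally show ?thesis .
qed

end

section \<open>Local moves\<close>

lemma compact_unit_square: "compact unit_square"
proof -
  have "unit_square = cbox (Complex (-1) (-1)) (Complex 1 1)"
    by (auto simp: unit_square_def in_cbox_complex_iff)
  then show ?thesis by (metis compact_cbox)
qed

lemma crossing_factor_add_2: "crossing_factor (n + 2) w = crossing_factor n w"
  by (simp add: crossing_factor_def)

lemma crossing_factor_square: "crossing_factor n w \<otimes>\<^bsub>A_group\<^esub> crossing_factor n w = \<one>\<^bsub>A_group\<^esub>"
  by (simp add: crossing_factor_def A_gen_square)

text \<open>The two sides of a Reidemeister move. The assumption \<open>same_totals\<close> says that the indices on every strand have the
  same total on both sides; this is what a walk that runs through the whole strand sees.\<close>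

locale local_move =
  old: shown_picture D h Is T + new: shown_picture D' k Is T'
  for D h Is T D' k T' +
  assumes same_disk: "k ` unit_square = h ` unit_square"
    and agree: "\<And>t. curve D t \<notin> h ` unit_square \<Longrightarrow> curve D' t = curve D t \<and> mark D' t = mark D t"
    and same_totals: "\<And>g :: nat \<Rightarrow> int. (\<Sum>(i, v)\<in>picture_ends T'. picture_index Is T' i v * g i)
      = (\<Sum>(i, v)\<in>picture_ends T. picture_index Is T i v * g i)"
begin

text \<open>Both pictures occupy the same parameter intervals, and lie in the disk there.\<close>

lemma in_disk_iff: "curve D' t \<in> old.disk \<longleftrightarrow> curve D t \<in> old.disk"
proof
  assume "curve D' t \<in> old.disk"
  then show "curve D t \<in> old.disk" using agree by metis
next
  assume "curve D t \<in> old.disk"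
  then obtain i u where iu: "i < length T" "u \<in> {-1..1}" "t - on_strand Is i u \<in> \<int>"
    by (rule old.curve_in_disk)
  have "i < length T'"
    using iu(1) old.shown new.shown by (simp add: shows_picture_def)
  then have "curve D' (on_strand Is i u) \<in> new.disk" using new.strand_in_disk iu by blast
  then show "curve D' t \<in> old.disk" using new.curve_cong[OF iu(3)] by (simp only: same_disk)
qed

text \<open>The velocity at a point is determined by the curve near this point, and the disk is closed.\<close>

lemma velocity_outside:
  assumes "curve D t \<notin> old.disk"
  shows "velocity D' t = velocity D t"
proof -
  have "continuous_on UNIV (curve D)"
    using old.curve_derivative
    by (meson continuous_at_imp_continuous_on has_vector_derivative_continuous)
  moreover have "closed old.disk"
  proof (intro compact_imp_closed compact_continuous_image compact_unit_square)
    obtain h' where "\<And>z. (h has_derivative h' z) (at z)"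
      using old.shown unfolding shows_picture_def plane_diffeo_def by blast
    then show "continuous_on unit_square h"
      by (meson continuous_at_imp_continuous_on has_derivative_continuous)
  qed
  ultimately have op: "open (- (curve D -` old.disk))"
    by (metis closed_vimage open_Compl)
  have "(curve D' has_vector_derivative velocity D t) (at t)"
    by (rule has_vector_derivative_transform_within_open[OF old.curve_derivative op])
       (use assms agree in auto)
  then show ?thesis using new.curve_derivative vector_derivative_unique_at by blast
qed

lemma double_point_outside:
  assumes p: "curve D p \<notin> old.disk"
  shows "double_point D' p q \<longleftrightarrow> double_point D p q"
proof (cases "curve D q \<in> old.disk")
  case True
  then have "curve D' q \<in> old.disk" using in_disk_iff by blast
  then show ?thesis using True p agree[OF p] by (metis double_point_def)
next
  case False
  then show ?thesis using agree[OF p] agree[OF False] by (simp add: double_point_def)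
qed

lemma crossing_index_outside:
  assumes p: "curve D p \<notin> old.disk"
  shows "crossing_index D' p = crossing_index D p"
proof -
  have "double_point D' p q \<and> turn (velocity D' p) (velocity D' q) > 0 \<longleftrightarrow>
      double_point D p q \<and> turn (velocity D p) (velocity D q) > 0" for q
  proof (cases "double_point D p q")
    case True
    then have "curve D q \<notin> old.disk" using p by (simp add: double_point_def)
    then show ?thesis by (simp add: double_point_outside[OF p] velocity_outside p)
  qed (simp add: double_point_outside[OF p])
  then show ?thesis by (simp add: crossing_index_def)
qed

lemma outer_index_eq: "outer_index D' old.disk a b = outer_index D old.disk a b"
proof -
  have "{p \<in> endpoints D'. curve D' p \<notin> old.disk} = {p \<in> endpoints D. curve D p \<notin> old.disk}"
    using agree in_disk_iff by (auto simp: endpoints_def)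
  then show ?thesis
    unfolding outer_index_def by (auto intro!: sum.cong simp: crossing_index_outside)
qed

lemma outer_arrows_eq: "outer_arrows D' old.disk = outer_arrows D old.disk"
proof -
  have "c \<in> outer_arrows D' old.disk \<longleftrightarrow> c \<in> outer_arrows D old.disk" for c
  proof (cases "curve D (fst c) \<in> old.disk")
    case True
    then show ?thesis using in_disk_iff by (simp add: outer_arrows_def)
  next
    case False
    have "(fst c, snd c) \<in> arrows D' \<longleftrightarrow> (fst c, snd c) \<in> arrows D"
      unfolding arrows_def mem_Collect_eq case_prod_conv double_point_outside[OF False]
      using agree[OF False] agree[of "snd c"] False by (auto simp: double_point_def)
    then show ?thesis using False in_disk_iff by (simp add: outer_arrows_def)
  qed
  then show ?thesis by blast
qed

lemma weight_outer_eq: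
  assumes "c \<in> outer_arrows D old.disk"
  shows "weight D' c = weight D c"
  using old.weight_outer[OF assms] new.weight_outer[of c] assms
  by (simp add: same_disk outer_arrows_eq outer_index_eq
      same_totals[of "\<lambda>k. of_bool (cyc (fst c) (on_strand Is k 0) (snd c))"])

lemma weight_inner_eq:
  assumes "(i, j, u) \<in> picture_crossings T'"
  shows "weight D' (inner_arrow Is (i, j, u)) =
    outer_index D old.disk (on_strand Is i 0) (on_strand Is j 0) + inner_index Is T' i j u"
  using new.weight_inner[OF assms] by (simp add: same_disk outer_index_eq)

lemma Phi_fr_new:
  "Phi_fr D' =
     (\<Otimes>\<^bsub>A_group\<^esub> c\<in>outer_arrows D old.disk. crossing_factor (card (arrows D')) (weight D c)) \<otimes>\<^bsub>A_group\<^esub>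
     (\<Otimes>\<^bsub>A_group\<^esub> x\<in>picture_crossings T'. crossing_factor (card (arrows D')) (weight D' (inner_arrow Is x)))"
proof -
  have "(\<Otimes>\<^bsub>A_group\<^esub> c\<in>outer_arrows D old.disk. crossing_factor (card (arrows D')) (weight D' c)) =
      (\<Otimes>\<^bsub>A_group\<^esub> c\<in>outer_arrows D old.disk. crossing_factor (card (arrows D')) (weight D c))"
    by (rule A.finprod_cong') (auto simp: weight_outer_eq)
  then show ?thesis unfolding new.Phi_fr_split same_disk outer_arrows_eq by (simp only:)
qed

text \<open>The map \<open>f\<close> gives the new position of a crossing on its strands.\<close>

lemma Phi_fr_bijective_move:
  assumes bij: "bij_betw (\<lambda>(i, j, u). (i, j, f u)) (picture_crossings T) (picture_crossings T')"
    and index: "\<And>i j u. (i, j, u) \<in> picture_crossings T \<Longrightarrow> inner_index Is T' i j (f u) = inner_index Is T i j u"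
  shows "Phi_fr D' = Phi_fr D"
proof -
  let ?f = "\<lambda>(i :: nat, j :: nat, u :: real). (i, j, f u)"
  have img: "picture_crossings T' = ?f ` picture_crossings T" and inj: "inj_on ?f (picture_crossings T)"
    using bij by (auto simp: bij_betw_def)
  have card: "card (arrows D') = card (arrows D)"
    using bij_betw_same_card[OF bij]
    by (simp add: old.card_arrows_split new.card_arrows_split same_disk outer_arrows_eq)
  have weight: "weight D' (inner_arrow Is (?f x)) = weight D (inner_arrow Is x)"
    if x: "x \<in> picture_crossings T" for x
  proof -
    obtain i j u where def: "x = (i, j, u)" by (metis prod_cases3)
    have "?f x \<in> picture_crossings T'" using x img by blast
    then have x': "(i, j, f u) \<in> picture_crossings T'" by (simp add: def)
    show ?thesis
      using weight_inner_eq[OF x'] old.weight_inner[OF x[unfolded def]] index[OF x[unfolded def]]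
      by (simp add: def)
  qed
  have "(\<Otimes>\<^bsub>A_group\<^esub> x\<in>picture_crossings T'. crossing_factor (card (arrows D')) (weight D' (inner_arrow Is x)))
      = (\<Otimes>\<^bsub>A_group\<^esub> x\<in>picture_crossings T. crossing_factor (card (arrows D')) (weight D' (inner_arrow Is (?f x))))"
    unfolding img by (rule A.finprod_reindex[OF _ inj]) auto
  also have "\<dots> = (\<Otimes>\<^bsub>A_group\<^esub> x\<in>picture_crossings T. crossing_factor (card (arrows D)) (weight D (inner_arrow Is x)))"
    by (rule A.finprod_cong') (auto simp: weight card simp del: split_paired_All)
  finally show ?thesis unfolding Phi_fr_new old.Phi_fr_split by (simp add: card)
qed

text \<open>The number of crossings increases by 2, which preserves the factors of the old crossings, and the two new
  factors are equal and square to one.\<close>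

lemma Phi_fr_cancelling_move:
  assumes none: "picture_crossings T = {}"
    and two: "picture_crossings T' = {(i, j, u), (i, j, v)}" "u \<noteq> v"
    and index: "inner_index Is T' i j u = inner_index Is T' i j v"
  shows "Phi_fr D' = Phi_fr D"
proof -
  have card: "card (arrows D') = card (arrows D) + 2"
    unfolding old.card_arrows_split new.card_arrows_split same_disk outer_arrows_eq none two
    using two(2) by simp
  have "weight D' (inner_arrow Is (i, j, u)) = weight D' (inner_arrow Is (i, j, v))"
    using weight_inner_eq[of i j u] weight_inner_eq[of i j v] index two by simp
  then have "(\<Otimes>\<^bsub>A_group\<^esub> x\<in>picture_crossings T'. crossing_factor (card (arrows D')) (weight D' (inner_arrow Is x)))
      = \<one>\<^bsub>A_group\<^esub>"
    unfolding two using two(2) by (simp add: crossing_factor_square)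
  moreover have "(\<Otimes>\<^bsub>A_group\<^esub> c\<in>outer_arrows D old.disk. crossing_factor (card (arrows D')) (weight D c))
      \<in> carrier A_group" by (rule A.finprod_closed) auto
  ultimately show ?thesis
    unfolding Phi_fr_new old.Phi_fr_split none card crossing_factor_add_2 by simp
qed

end

section \<open>Tameness of the standard pictures\<close>

lemma classical_opposite: "classical (opposite m) \<longleftrightarrow> classical m"
  by (cases m) auto

lemma opposite_eq_simps [simp]:
  "opposite m = Over \<longleftrightarrow> m = Under" "opposite m = Under \<longleftrightarrow> m = Over"
  by (cases m; simp)+

lemma has_vector_derivative_graph:
  assumes "(g has_real_derivative g') (at u)"
  shows "((\<lambda>u. Complex u (g u)) has_vector_derivative Complex 1 g') (at u)"
proof -
  have "((\<lambda>u. complex_of_real u + \<i> * complex_of_real (g u)) has_vector_derivative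
      complex_of_real 1 + \<i> * complex_of_real g') (at u)"
    by (intro has_vector_derivative_add has_vector_derivative_of_real has_vector_derivative_mult_right
        assms DERIV_ident)
  then show ?thesis by (simp add: Complex_eq)
qed

lemma tame_graphs:
  assumes graphs: "\<And>i. i < length T \<Longrightarrow> fst (T ! i) = (\<lambda>u. Complex u (g i u))"
    and diff: "\<And>i u. i < length T \<Longrightarrow> (g i has_real_derivative g' i u) (at u)"
    and bound: "\<And>i u. i < length T \<Longrightarrow> \<bar>u\<bar> \<le> 1 \<Longrightarrow> \<bar>g i u\<bar> \<le> 1"
    and ends: "finite (picture_ends T)" "\<And>i u. (i, u) \<in> picture_ends T \<Longrightarrow> \<bar>u\<bar> < 1"
  shows "tame_picture T"
  unfolding tame_picture_def
proof (intro conjI ballI allI impI)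
  show "fst (T ! i) u \<in> unit_square" if "i < length T" "u \<in> {-1..1}" for i u
    using bound[OF that(1), of u] that by (auto simp: graphs unit_square_def)
  fix x assume x: "x \<in> picture_ends T"
  obtain i u where def: "x = (i, u)" by (cases x)
  have i: "i < length T" using x by (auto simp: def picture_ends_def)
  have "fst (T ! i) differentiable (at u)"
    unfolding graphs[OF i] using has_vector_derivative_graph[OF diff[OF i]] differentiableI_vector by blast
  then show "case x of (i, u) \<Rightarrow> \<bar>u\<bar> < 1 \<and> fst (T ! i) differentiable (at u) \<and>
        (\<forall>j<length T. \<forall>v\<in>{-1..1}. fst (T ! j) v = fst (T ! i) u \<longrightarrow> v = u)"
    using ends(2)[of i u] x i by (auto simp: def graphs)
qed (rule ends)

lemma picture_velocity_graph:
  assumes "fst (T ! i) = (\<lambda>u. Complex u (g u))" "(g has_real_derivative g') (at u)"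
  shows "picture_velocity T i u = Complex 1 g'"
  unfolding picture_velocity_def assms(1)
  by (rule vector_derivative_at has_vector_derivative_graph assms(2))+

lemma picture_ends_strand: "picture_ends strand_picture = {}"
  by (auto simp: picture_ends_def strand_picture_def)

lemma picture_ends_parallel: "picture_ends parallel_picture = {}"
  by (auto simp: picture_ends_def parallel_picture_def less_2_cases_iff nth_Cons')

lemma picture_ends_curl: "picture_ends virtual_curl_picture = {}"
  by (auto simp: picture_ends_def virtual_curl_picture_def fun_upd_def split: if_splits)

lemma picture_crossings_no_ends: "picture_ends T = {} \<Longrightarrow> picture_crossings T = {}"
  by (auto simp: picture_crossings_def)

lemma tame_strand: "tame_picture strand_picture"
  by (rule tame_graphs[where g = "\<lambda>_ _. 1/2" and g' = "\<lambda>_ _. 0"])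
     (auto simp: picture_ends_strand, auto simp: strand_picture_def)

lemma tame_parallel: "tame_picture parallel_picture"
  by (rule tame_graphs[where g = "\<lambda>i _. if i = 0 then 0 else 1/2" and g' = "\<lambda>_ _. 0"])
     (auto simp: picture_ends_parallel, auto simp: parallel_picture_def less_2_cases_iff nth_Cons')

lemma tame_curl: "tame_picture virtual_curl_picture"
proof -
  have "fst (virtual_curl_picture ! 0) u \<in> unit_square" if u: "\<bar>u\<bar> \<le> 1" for u :: real
  proof -
    have sq: "0 \<le> u\<^sup>2" "u\<^sup>2 \<le> 1" using u by (simp_all add: abs_square_le_1)
    then have "\<bar>4 * u\<^sup>2 - 1\<bar> \<le> 3" by linarith
    then have "\<bar>u\<bar> * \<bar>4 * u\<^sup>2 - 1\<bar> \<le> 1 * 3" using u by (intro mult_mono) auto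
    moreover have "4 * u ^ 3 - u = u * (4 * u\<^sup>2 - 1)"
      by (simp add: power2_eq_square power3_eq_cube algebra_simps)
    ultimately have "\<bar>4 * u ^ 3 - u\<bar> \<le> 3" by (simp add: abs_mult)
    then show ?thesis using sq by (simp add: virtual_curl_picture_def unit_square_def)
  qed
  then show ?thesis
    unfolding tame_picture_def picture_ends_curl by (simp add: virtual_curl_picture_def abs_le_iff)
qed

section \<open>The second move\<close>

definition sign_index :: "real \<Rightarrow> int" where
  "sign_index x = (if x > 0 then -1 else 1)"

lemma sign_index_minus: "x \<noteq> 0 \<Longrightarrow> sign_index (- x) = - sign_index x"
  by (simp add: sign_index_def)

lemma picture_index_unique:
  assumes "\<And>l. partner_strand T i u l \<longleftrightarrow> l = j"
  shows "picture_index Is T i u = sign_index (strand_dir Is i * strand_dir Is j *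
    turn (picture_velocity T i u) (picture_velocity T j u))"
  using assms by (simp add: picture_index_def sign_index_def)

lemma bigon_strand_0: "fst (bigon_picture m ! 0) = (\<lambda>u. Complex u 0)"
  and bigon_strand_1: "fst (bigon_picture m ! 1) = (\<lambda>u. Complex u (u\<^sup>2 - 1/4))"
  and length_bigon: "length (bigon_picture m) = 2"
  by (simp_all add: bigon_picture_def)

lemma picture_ends_bigon:
  "picture_ends (bigon_picture m) = (if classical m then {0, 1} \<times> {-1/2, 1/2} else {})"
  by (auto simp: picture_ends_def bigon_picture_def less_2_cases_iff nth_Cons' fun_upd_def split: if_splits)

lemma tame_bigon: "tame_picture (bigon_picture m)"
proof (rule tame_graphs[where g = "\<lambda>i u. if i = 0 then 0 else u\<^sup>2 - 1/4" and g' = "\<lambda>i u. if i = 0 then 0 else 2 * u"])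
  fix i assume "i < length (bigon_picture m)"
  then have i: "i = 0 \<or> i = 1" by (auto simp: length_bigon)
  then show "fst (bigon_picture m ! i) = (\<lambda>u. Complex u (if i = 0 then 0 else u\<^sup>2 - 1/4))"
    using bigon_strand_0 bigon_strand_1 by auto
  show "((\<lambda>u. if i = 0 then 0 else u\<^sup>2 - 1/4) has_real_derivative (if i = 0 then 0 else 2 * u)) (at u)" for u
    by (cases "i = 0") (auto intro!: derivative_eq_intros)
  show "\<bar>if i = 0 then 0 else u\<^sup>2 - 1/4\<bar> \<le> 1" if "\<bar>u\<bar> \<le> 1" for u :: real
  proof -
    have "0 \<le> u\<^sup>2" "u\<^sup>2 \<le> 1" using that by (simp_all add: abs_square_le_1)
    then have "\<bar>u\<^sup>2 - 1/4\<bar> \<le> 1" by linarith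
    then show ?thesis by simp
  qed
qed (auto simp: picture_ends_bigon split: if_splits)

lemma partner_strand_bigon:
  assumes "u \<in> {-1/2, 1/2}"
  shows "partner_strand (bigon_picture m) 0 u j \<longleftrightarrow> j = 1" "partner_strand (bigon_picture m) 1 u j \<longleftrightarrow> j = 0"
proof -
  have u: "u\<^sup>2 - 1/4 = 0" using assms by (elim insertE emptyE; hypsubst; simp add: power2_eq_square)
  show "partner_strand (bigon_picture m) 0 u j \<longleftrightarrow> j = 1" "partner_strand (bigon_picture m) 1 u j \<longleftrightarrow> j = 0"
    unfolding partner_strand_def length_bigon less_2_cases_iff
    using bigon_strand_0 bigon_strand_1 u by (auto simp flip: One_nat_def)
qed

lemma picture_velocity_bigon:
  "picture_velocity (bigon_picture m) 0 u = Complex 1 0"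
  "picture_velocity (bigon_picture m) 1 u = Complex 1 (2 * u)"
  by (rule picture_velocity_graph[OF bigon_strand_0], simp)
     (rule picture_velocity_graph[OF bigon_strand_1], auto intro!: derivative_eq_intros)

lemma picture_index_bigon:
  "picture_index Is (bigon_picture m) 0 (-1/2) = sign_index (- (strand_dir Is 0 * strand_dir Is 1))"
  "picture_index Is (bigon_picture m) 0 (1/2) = sign_index (strand_dir Is 0 * strand_dir Is 1)"
  "picture_index Is (bigon_picture m) 1 (-1/2) = sign_index (strand_dir Is 0 * strand_dir Is 1)"
  "picture_index Is (bigon_picture m) 1 (1/2) = sign_index (- (strand_dir Is 0 * strand_dir Is 1))"
  by (subst picture_index_unique, rule partner_strand_bigon,
      simp, simp add: picture_velocity_bigon[unfolded One_nat_def] picture_velocity_bigon turn_coords mult.commute)+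

lemma sum_bigon_ends:
  assumes "classical m"
  shows "(\<Sum>(k, v)\<in>picture_ends (bigon_picture m). F k v) = F 0 (-1/2) + F 0 (1/2) + F 1 (-1/2) + (F 1 (1/2) :: int)"
proof -
  have "picture_ends (bigon_picture m) = {(0, -1/2), (0, 1/2), (1, -1/2), (1, 1/2)}"
    using assms by (auto simp: picture_ends_bigon)
  then show ?thesis by simp
qed

lemma sum_bigon_index:
  assumes "classical m"
  shows "(\<Sum>(k, v)\<in>picture_ends (bigon_picture m). picture_index Is (bigon_picture m) k v * F k v) =
    sign_index (- (strand_dir Is 0 * strand_dir Is 1)) * F 0 (-1/2)
    + sign_index (strand_dir Is 0 * strand_dir Is 1) * F 0 (1/2)
    + sign_index (strand_dir Is 0 * strand_dir Is 1) * F 1 (-1/2)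
    + sign_index (- (strand_dir Is 0 * strand_dir Is 1)) * F 1 (1/2)"
  unfolding sum_bigon_ends[OF assms] by (simp only: picture_index_bigon)

lemma picture_crossings_bigon:
  "picture_crossings (bigon_picture Over) = {(0, 1, -1/2), (0, 1, 1/2)}"
  "picture_crossings (bigon_picture Under) = {(1, 0, -1/2), (1, 0, 1/2)}"
proof -
  have ends: "(i, j, u) \<in> picture_crossings (bigon_picture m) \<longleftrightarrow>
      u \<in> {-1/2, 1/2} \<and> (i = 0 \<and> j = 1 \<or> i = 1 \<and> j = 0) \<and> snd (bigon_picture m ! i) u = Over"
    if "classical m" for m i j u
    using that by (auto simp: picture_crossings_def picture_ends_bigon partner_strand_bigon
        partner_strand_bigon[unfolded One_nat_def])
  show "picture_crossings (bigon_picture Over) = {(0, 1, -1/2), (0, 1, 1/2)}"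
    "picture_crossings (bigon_picture Under) = {(1, 0, -1/2), (1, 0, 1/2)}"
    using ends[of Over] ends[of Under] by (auto simp: bigon_picture_def)
qed

text \<open>The two strands cross from opposite sides at the two corners of the bigon.\<close>

lemma bigon_totals:
  assumes dir: "strand_dir Is 0 \<noteq> 0" "strand_dir Is 1 \<noteq> 0"
  shows "(\<Sum>(i, v)\<in>picture_ends (bigon_picture m). picture_index Is (bigon_picture m) i v * g i) = (0 :: int)"
proof (cases "classical m")
  case True
  have "sign_index (- (strand_dir Is 0 * strand_dir Is 1)) = - sign_index (strand_dir Is 0 * strand_dir Is 1)"
    using dir by (simp add: sign_index_minus)
  then show ?thesis unfolding sum_bigon_index[OF True] by simp
qed (simp add: picture_ends_bigon)

text \<open>The walks from the two corners differ by one passage on each strand. For strands in the same direction, say,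
  one walk has an additional passage at its beginning and the other one at its end. These are passages at different corners
  on different strands, and have the same index.\<close>

lemma bigon_inner_index:
  assumes m: "classical m" and dir: "strand_dir Is 0 \<noteq> 0" "strand_dir Is 1 \<noteq> 0"
    and ij: "i = 0 \<and> j = 1 \<or> i = 1 \<and> j = 0"
  shows "inner_index Is (bigon_picture m) i j (-1/2) = inner_index Is (bigon_picture m) i j (1/2)"
proof -
  have "strand_dir Is 0 < 0 \<or> strand_dir Is 0 > 0" "strand_dir Is 1 < 0 \<or> strand_dir Is 1 > 0"
    using dir by auto
  then show ?thesis
    unfolding inner_index_def sum_bigon_index[OF m] using ij
    by (elim disjE conjE)
       (simp_all add: on_arc_def sign_index_def zero_less_mult_iff mult_less_0_iff not_less)
qed

section \<open>The third move\<close>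

text \<open>Exactly two classical crossings occur in the forbidden moves only, where the weight of a
  crossing changes by the contribution of a single passage.\<close>

lemma triangle_marks_classical:
  assumes "triangle_marks a b c"
  shows "classical a \<and> classical b \<and> classical c \<or> \<not> classical a \<and> \<not> classical b
    \<or> \<not> classical a \<and> \<not> classical c \<or> \<not> classical b \<and> \<not> classical c"
  using assms
proof cases
  case (classical x y z)
  have "classical (by_height p q)" for p q by (simp add: by_height_def)
  then show ?thesis unfolding classical(1-3) by blast
next
  case detour1
  then have "\<not> classical a" "\<not> classical b" by simp_all
  then show ?thesis by blast
next
  case detour2
  then have "\<not> classical a" "\<not> classical c" by simp_all
  then show ?thesis by blast
next
  case detour3
  then have "\<not> classical b" "\<not> classical c" by simp_all
  then show ?thesis by blast
qed

lemma less_3_iff: "i < (3 :: nat) \<longleftrightarrow> i = 0 \<or> i = 1 \<or> i = 2" by auto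

lemma triangle_strand_0: "fst (triangle_picture e a b c ! 0) = (\<lambda>u. Complex u (u / 2))"
  and triangle_strand_1: "fst (triangle_picture e a b c ! 1) = (\<lambda>u. Complex u (- u / 2))"
  and triangle_strand_2: "fst (triangle_picture e a b c ! 2) = (\<lambda>u. Complex u e)"
  and length_triangle: "length (triangle_picture e a b c) = 3"
  by (simp_all add: triangle_picture_def)

lemma triangle_marks_0: "snd (triangle_picture e a b c ! 0) = unmarked(0 := a, 2 * e := b)"
  and triangle_marks_1: "snd (triangle_picture e a b c ! 1) = unmarked(0 := opposite a, - 2 * e := c)"
  and triangle_marks_2: "snd (triangle_picture e a b c ! 2) = unmarked(2 * e := opposite b, - 2 * e := opposite c)"
  by (simp_all add: triangle_picture_def)

lemma classical_two_marks:
  "x \<noteq> y \<Longrightarrow> classical ((unmarked(x := m, y := n)) u) \<longleftrightarrow> u = x \<and> classical m \<or> u = y \<and> classical n"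
  by auto

lemma picture_ends_triangle:
  assumes "\<bar>e\<bar> = 1/4"
  shows "picture_ends (triangle_picture e a b c) =
    (if classical a then {(0, 0), (1, 0)} else {}) \<union>
    (if classical b then {(0, 2 * e), (2, 2 * e)} else {}) \<union>
    (if classical c then {(1, - 2 * e), (2, - 2 * e)} else {})" (is "?E = ?R")
proof -
  have e: "0 \<noteq> 2 * e" "0 \<noteq> - 2 * e" "2 * e \<noteq> - 2 * e" using assms by auto
  have interior: "0 \<in> {-1..1 :: real}" "2 * e \<in> {-1..1}" "- 2 * e \<in> {-1..1}"
    using assms by (auto simp: abs_if split: if_splits)
  have E0: "(0, u) \<in> ?E \<longleftrightarrow> u = 0 \<and> classical a \<or> u = 2 * e \<and> classical b" for u
    unfolding picture_ends_def mem_Collect_eq case_prod_conv triangle_marks_0 classical_two_marks[OF e(1)] length_triangle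
    using interior by auto
  have E1: "(1, u) \<in> ?E \<longleftrightarrow> u = 0 \<and> classical a \<or> u = - 2 * e \<and> classical c" for u
    unfolding picture_ends_def mem_Collect_eq case_prod_conv triangle_marks_1 classical_two_marks[OF e(2)] length_triangle
      classical_opposite
    using interior by auto
  have E2: "(2, u) \<in> ?E \<longleftrightarrow> u = 2 * e \<and> classical b \<or> u = - 2 * e \<and> classical c" for u
    unfolding picture_ends_def mem_Collect_eq case_prod_conv triangle_marks_2 classical_two_marks[OF e(3)] length_triangle
      classical_opposite
    using interior by auto
  have R: "(i, u) \<in> (if A then {(0, x), (1, x)} else {}) \<union> (if B then {(0, y), (2, y)} else {})
      \<union> (if C then {(1, z), (2, z)} else {}) \<longleftrightarrow>
      u = x \<and> A \<and> (i = 0 \<or> i = 1) \<or> u = y \<and> B \<and> (i = 0 \<or> i = 2) \<or> u = z \<and> C \<and> (i = 1 \<or> i = 2)"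
    for A B C x y z u and i :: nat
    by auto
  have "(i, u) \<in> ?E \<longleftrightarrow> (i, u) \<in> ?R" for i u
  proof -
    consider (zero) "i = 0" | (one) "i = 1" | (two) "i = 2" | (more) "\<not> i < 3" by linarith
    then show ?thesis
    proof cases
      case zero
      show ?thesis unfolding zero R E0 by simp
    next
      case one
      show ?thesis unfolding one R E1 by simp
    next
      case two
      show ?thesis unfolding two R E2 by simp
    next
      case more
      then have "(i, u) \<notin> ?E" by (simp add: picture_ends_def length_triangle)
      then show ?thesis using more unfolding R by auto
    qed
  qed
  then show ?thesis by (simp only: set_eq_iff split_paired_All) blast
qed

lemma tame_triangle:
  assumes e: "\<bar>e\<bar> = 1/4"
  shows "tame_picture (triangle_picture e a b c)"
proof (rule tame_graphs[where g = "\<lambda>i u. if i = 0 then u / 2 else if i = 1 then - u / 2 else e"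
      and g' = "\<lambda>i u. if i = 0 then 1/2 else if i = 1 then - 1/2 else 0"])
  fix i assume "i < length (triangle_picture e a b c)"
  then have i: "i = 0 \<or> i = 1 \<or> i = 2" by (auto simp: length_triangle)
  then show "fst (triangle_picture e a b c ! i) = (\<lambda>u. Complex u (if i = 0 then u / 2 else if i = 1 then - u / 2 else e))"
    using triangle_strand_0 triangle_strand_1 triangle_strand_2 by auto
  show "((\<lambda>u. if i = 0 then u / 2 else if i = 1 then - u / 2 else e) has_real_derivative
      (if i = 0 then 1/2 else if i = 1 then - 1/2 else 0)) (at u)" for u
    using i by (auto intro!: derivative_eq_intros)
  show "\<bar>if i = 0 then u / 2 else if i = 1 then - u / 2 else e\<bar> \<le> 1" if "\<bar>u\<bar> \<le> 1" for u :: real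
    using that e by auto
next
  show "finite (picture_ends (triangle_picture e a b c))" unfolding picture_ends_triangle[OF e] by simp
  have "\<bar>2 * e\<bar> < 1" "\<bar>- 2 * e\<bar> < 1" using e by linarith+
  then show "\<bar>u\<bar> < 1" if "(i, u) \<in> picture_ends (triangle_picture e a b c)" for i u
    using that unfolding picture_ends_triangle[OF e] by (auto split: if_splits)
qed

lemma partner_strand_triangle:
  assumes "e \<noteq> 0"
  shows "partner_strand (triangle_picture e a b c) 0 u j \<longleftrightarrow> u = 0 \<and> j = 1 \<or> u = 2 * e \<and> j = 2"
    "partner_strand (triangle_picture e a b c) 1 u j \<longleftrightarrow> u = 0 \<and> j = 0 \<or> u = - 2 * e \<and> j = 2"
    "partner_strand (triangle_picture e a b c) 2 u j \<longleftrightarrow> u = 2 * e \<and> j = 0 \<or> u = - 2 * e \<and> j = 1"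
  unfolding partner_strand_def length_triangle less_3_iff
  by (use assms triangle_strand_0 triangle_strand_1 triangle_strand_2 in \<open>auto simp flip: One_nat_def\<close>)

lemma picture_velocity_triangle:
  "picture_velocity (triangle_picture e a b c) 0 u = Complex 1 (1/2)"
  "picture_velocity (triangle_picture e a b c) 1 u = Complex 1 (-1/2)"
  "picture_velocity (triangle_picture e a b c) 2 u = Complex 1 0"
proof -
  have d: "((\<lambda>u. u / 2) has_real_derivative 1/2) (at u)" "((\<lambda>u. - u / 2) has_real_derivative - 1/2) (at u)"
    "((\<lambda>u. e) has_real_derivative 0) (at u)"
    by (auto intro!: derivative_eq_intros)
  show "picture_velocity (triangle_picture e a b c) 0 u = Complex 1 (1/2)"
    by (rule picture_velocity_graph[OF triangle_strand_0 d(1)])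
  show "picture_velocity (triangle_picture e a b c) 1 u = Complex 1 (-1/2)"
    by (rule picture_velocity_graph[OF triangle_strand_1 d(2)])
  show "picture_velocity (triangle_picture e a b c) 2 u = Complex 1 0"
    by (rule picture_velocity_graph[OF triangle_strand_2 d(3)])
qed

lemma picture_index_triangle:
  assumes e: "e \<noteq> 0"
  shows "picture_index Is (triangle_picture e a b c) 0 0 = sign_index (- (strand_dir Is 0 * strand_dir Is 1))"
    "picture_index Is (triangle_picture e a b c) 1 0 = sign_index (strand_dir Is 0 * strand_dir Is 1)"
    "picture_index Is (triangle_picture e a b c) 0 (2 * e) = sign_index (- (strand_dir Is 0 * strand_dir Is 2))"
    "picture_index Is (triangle_picture e a b c) 2 (2 * e) = sign_index (strand_dir Is 0 * strand_dir Is 2)"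
    "picture_index Is (triangle_picture e a b c) 1 (- 2 * e) = sign_index (strand_dir Is 1 * strand_dir Is 2)"
    "picture_index Is (triangle_picture e a b c) 2 (- 2 * e) = sign_index (- (strand_dir Is 1 * strand_dir Is 2))"
proof -
  let ?T = "triangle_picture e a b c"
  note simps = picture_velocity_triangle turn_coords sign_index_def mult.commute[of "strand_dir Is 1" "strand_dir Is 0"]
    mult.commute[of "strand_dir Is 2" "strand_dir Is 0"] mult.commute[of "strand_dir Is 2" "strand_dir Is 1"]
  have "\<And>l. partner_strand ?T 0 0 l \<longleftrightarrow> l = 1" using e by (simp add: partner_strand_triangle)
  then show "picture_index Is ?T 0 0 = sign_index (- (strand_dir Is 0 * strand_dir Is 1))"
    by (subst picture_index_unique) (assumption, simp add: simps flip: One_nat_def)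
  have "\<And>l. partner_strand ?T 1 0 l \<longleftrightarrow> l = 0" unfolding partner_strand_triangle[OF e] using e by simp
  then show "picture_index Is ?T 1 0 = sign_index (strand_dir Is 0 * strand_dir Is 1)"
    by (subst picture_index_unique) (assumption, simp add: simps flip: One_nat_def)
  have "\<And>l. partner_strand ?T 0 (2 * e) l \<longleftrightarrow> l = 2" using e by (simp add: partner_strand_triangle)
  then show "picture_index Is ?T 0 (2 * e) = sign_index (- (strand_dir Is 0 * strand_dir Is 2))"
    by (subst picture_index_unique) (assumption, simp add: simps flip: One_nat_def)
  have "\<And>l. partner_strand ?T 2 (2 * e) l \<longleftrightarrow> l = 0" using e by (simp add: partner_strand_triangle)
  then show "picture_index Is ?T 2 (2 * e) = sign_index (strand_dir Is 0 * strand_dir Is 2)"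
    by (subst picture_index_unique) (assumption, simp add: simps flip: One_nat_def)
  have "\<And>l. partner_strand ?T 1 (- 2 * e) l \<longleftrightarrow> l = 2" unfolding partner_strand_triangle[OF e] using e by simp
  then show "picture_index Is ?T 1 (- 2 * e) = sign_index (strand_dir Is 1 * strand_dir Is 2)"
    by (subst picture_index_unique) (assumption, simp add: simps flip: One_nat_def)
  have "\<And>l. partner_strand ?T 2 (- 2 * e) l \<longleftrightarrow> l = 1" unfolding partner_strand_triangle[OF e] using e by simp
  then show "picture_index Is ?T 2 (- 2 * e) = sign_index (- (strand_dir Is 1 * strand_dir Is 2))"
    by (subst picture_index_unique) (assumption, simp add: simps flip: One_nat_def)
qed

lemma sum_triangle_ends:
  assumes e: "\<bar>e\<bar> = 1/4"
  shows "(\<Sum>(k, v)\<in>picture_ends (triangle_picture e a b c). F k v) =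
    of_bool (classical a) * (F 0 0 + F 1 0) + of_bool (classical b) * (F 0 (2 * e) + F 2 (2 * e))
    + of_bool (classical c) * (F 1 (- 2 * e) + (F 2 (- 2 * e) :: int))"
proof -
  have "e \<noteq> 0" using e by auto
  then have "(0, 0) \<noteq> (0 :: nat, 2 * e)" "(1, 0) \<noteq> (1 :: nat, - 2 * e)" "(2, 2 * e) \<noteq> (2 :: nat, - 2 * e)"
    by simp_all
  then show ?thesis unfolding picture_ends_triangle[OF e]
    by (cases "classical a"; cases "classical b"; cases "classical c") (simp_all flip: One_nat_def)
qed

text \<open>The indices do not depend on \<open>e\<close>, because the move translates the third strand. Only the order of the
  passages on the strands changes with the sign of \<open>e\<close>.\<close>

lemma sum_triangle_index:
  assumes e: "\<bar>e\<bar> = 1/4"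
  shows "(\<Sum>(k, v)\<in>picture_ends (triangle_picture e a b c).
      picture_index Is (triangle_picture e a b c) k v * F k v) =
    of_bool (classical a) * (sign_index (- (strand_dir Is 0 * strand_dir Is 1)) * F 0 0
      + sign_index (strand_dir Is 0 * strand_dir Is 1) * F 1 0)
    + of_bool (classical b) * (sign_index (- (strand_dir Is 0 * strand_dir Is 2)) * F 0 (2 * e)
      + sign_index (strand_dir Is 0 * strand_dir Is 2) * F 2 (2 * e))
    + of_bool (classical c) * (sign_index (strand_dir Is 1 * strand_dir Is 2) * F 1 (- 2 * e)
      + sign_index (- (strand_dir Is 1 * strand_dir Is 2)) * F 2 (- 2 * e))"
proof -
  have "e \<noteq> 0" using e by auto
  then show ?thesis unfolding sum_triangle_ends[OF e] by (simp only: picture_index_triangle[OF \<open>e \<noteq> 0\<close>])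
qed

lemma triangle_crossings_cases:
  assumes "(i, j, u) \<in> picture_crossings (triangle_picture e a b c)" and e: "\<bar>e\<bar> = 1/4"
  shows "classical a \<and> (i = 0 \<and> j = 1 \<or> i = 1 \<and> j = 0) \<and> u = 0 \<or>
    classical b \<and> (i = 0 \<and> j = 2 \<or> i = 2 \<and> j = 0) \<and> u = 2 * e \<or>
    classical c \<and> (i = 1 \<and> j = 2 \<or> i = 2 \<and> j = 1) \<and> u = - 2 * e"
proof -
  have e0: "e \<noteq> 0" using e by auto
  define A B C where "A = classical a" "B = classical b" "C = classical c"
  note defs = this
  have ends: "(i, u) \<in> picture_ends (triangle_picture e a b c)"
    and partner: "partner_strand (triangle_picture e a b c) i u j"
    using assms(1) by (auto simp: picture_crossings_def)
  have "A \<and> (i, u) \<in> {(0, 0), (1, 0)} \<or> B \<and> (i, u) \<in> {(0, 2 * e), (2, 2 * e)} \<or>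
      C \<and> (i, u) \<in> {(1, - 2 * e), (2, - 2 * e)}"
    using ends unfolding picture_ends_triangle[OF e] defs[symmetric] by (simp split: if_splits)
  then consider "A" "i = 0" "u = 0" | "A" "i = 1" "u = 0" | "B" "i = 0" "u = 2 * e" | "B" "i = 2" "u = 2 * e"
    | "C" "i = 1" "u = - 2 * e" | "C" "i = 2" "u = - 2 * e" by blast
  then show ?thesis
    unfolding defs[symmetric]
    by cases (use partner e0 in \<open>simp_all add: partner_strand_triangle[OF e0]
        partner_strand_triangle[OF e0, unfolded One_nat_def]\<close>)
qed

lemma sign_index_mult:
  assumes "x \<noteq> 0" "y \<noteq> 0"
  shows "sign_index (x * y) = (if 0 < x \<longleftrightarrow> 0 < y then -1 else 1)"
    "sign_index (- (x * y)) = (if 0 < x \<longleftrightarrow> 0 < y then 1 else -1)"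
  using assms by (auto simp: sign_index_def zero_less_mult_iff mult_less_0_iff)

text \<open>Let \<open>i\<close> and \<open>j\<close> be the strands of the crossing and \<open>k\<close> the third one. If the crossings with \<open>k\<close> are
  virtual, nothing is counted on either side. Otherwise the move changes whether the walk meets the
  passage of \<open>i\<close> at \<open>k\<close> and the passage of \<open>j\<close> at \<open>k\<close>. Reversing the direction of \<open>i\<close> reverses the index of its passage and also
  whether it is gained or lost, and likewise for \<open>j\<close>. So one may suppose that both strands cross \<open>k\<close> from the same
  side, and then the two passages have the same index. If \<open>k\<close> lies ahead of the crossing on both strands, then the walk
  meets \<open>k\<close> when it leaves along \<open>i\<close>. If \<open>k\<close> lies behind the crossing, then it meets \<open>k\<close> when it returns
  along \<open>j\<close>.\<close>

lemma triangle_inner_index: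
  assumes "(i, j, u) \<in> picture_crossings (triangle_picture (1/4) a b c)" "triangle_marks a b c"
    and dir: "strand_dir Is 0 \<noteq> 0" "strand_dir Is 1 \<noteq> 0" "strand_dir Is 2 \<noteq> 0"
  shows "inner_index Is (triangle_picture (-1/4) a b c) i j (- u) =
    inner_index Is (triangle_picture (1/4) a b c) i j u"
proof -
  have e: "\<bar>1/4\<bar> = (1/4 :: real)" "\<bar>-1/4\<bar> = (1/4 :: real)" by simp_all
  define A B C where "A = classical a" "B = classical b" "C = classical c"
  note defs = this
  have neg: "strand_dir Is 0 < 0 \<longleftrightarrow> \<not> 0 < strand_dir Is 0" "strand_dir Is 1 < 0 \<longleftrightarrow> \<not> 0 < strand_dir Is 1"
    "strand_dir Is 2 < 0 \<longleftrightarrow> \<not> 0 < strand_dir Is 2" using dir by auto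
  have marks: "A \<and> B \<and> C \<or> \<not> A \<and> \<not> B \<or> \<not> A \<and> \<not> C \<or> \<not> B \<and> \<not> C"
    using triangle_marks_classical[OF assms(2)] unfolding defs .
  have cross: "A \<and> (i = 0 \<and> j = 1 \<or> i = 1 \<and> j = 0) \<and> u = 0 \<or>
      B \<and> (i = 0 \<and> j = 2 \<or> i = 2 \<and> j = 0) \<and> u = 1/2 \<or>
      C \<and> (i = 1 \<and> j = 2 \<or> i = 2 \<and> j = 1) \<and> u = -1/2"
    using triangle_crossings_cases[OF assms(1) e(1)] unfolding defs by simp
  note eval = on_arc_def zero_less_mult_iff neg neg[unfolded One_nat_def]
  note expand = inner_index_def sum_triangle_index[OF e(1)] sum_triangle_index[OF e(2)] defs[symmetric]
    sign_index_mult[OF dir(1,2)] sign_index_mult[OF dir(1,3)] sign_index_mult[OF dir(2,3)]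
  from cross show ?thesis
  proof
    assume hyp: "A \<and> (i = 0 \<and> j = 1 \<or> i = 1 \<and> j = 0) \<and> u = 0"
    then have eq: "C \<longleftrightarrow> B" and u: "u = 0" and ij: "i = 0 \<and> j = 1 \<or> i = 1 \<and> j = 0" using marks by blast+
    from ij show ?thesis
      unfolding expand eq u by (elim disjE conjE) (simp_all add: eval)
  next
    assume "B \<and> (i = 0 \<and> j = 2 \<or> i = 2 \<and> j = 0) \<and> u = 1/2 \<or>
      C \<and> (i = 1 \<and> j = 2 \<or> i = 2 \<and> j = 1) \<and> u = -1/2"
    then show ?thesis
    proof
      assume hyp: "B \<and> (i = 0 \<and> j = 2 \<or> i = 2 \<and> j = 0) \<and> u = 1/2"
      then have eq: "C \<longleftrightarrow> A" and u: "u = 1/2" and ij: "i = 0 \<and> j = 2 \<or> i = 2 \<and> j = 0" using marks by blast+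
      from ij show ?thesis
        unfolding expand eq u by (elim disjE conjE) (simp_all add: eval)
    next
      assume hyp: "C \<and> (i = 1 \<and> j = 2 \<or> i = 2 \<and> j = 1) \<and> u = -1/2"
      then have eq: "B \<longleftrightarrow> A" and u: "u = -1/2" and ij: "i = 1 \<and> j = 2 \<or> i = 2 \<and> j = 1" using marks by blast+
      from ij show ?thesis
        unfolding expand eq u by (elim disjE conjE) (simp_all add: eval)
    qed
  qed
qed

lemma triangle_totals:
  "(\<Sum>(i, v)\<in>picture_ends (triangle_picture (-1/4) a b c).
      picture_index Is (triangle_picture (-1/4) a b c) i v * g i) =
   (\<Sum>(i, v)\<in>picture_ends (triangle_picture (1/4) a b c).
      picture_index Is (triangle_picture (1/4) a b c) i v * (g i :: int))"
proof -
  have e: "\<bar>1/4\<bar> = (1/4 :: real)" "\<bar>-1/4\<bar> = (1/4 :: real)" by simp_all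
  show ?thesis unfolding sum_triangle_index[OF e(1)] sum_triangle_index[OF e(2)] by (rule HOL.refl)
qed

text \<open>The two sides of the move are related by the rotation of the square by a half turn, which reverses the
  parameters of the strands.\<close>

lemma triangle_reflection:
  "bij_betw (\<lambda>(i, j, u). (i, j, - u)) (picture_crossings (triangle_picture e a b c))
     (picture_crossings (triangle_picture (- e) a b c))"
proof -
  have strand: "fst (triangle_picture (- e) a b c ! i) (- u) = - fst (triangle_picture e a b c ! i) u"
    and mark: "snd (triangle_picture (- e) a b c ! i) (- u) = snd (triangle_picture e a b c ! i) u"
    if "i < 3" for e i u
    using that by (auto simp: triangle_picture_def less_3_iff complex_eq_iff)
  have refl: "(i, j, - u) \<in> picture_crossings (triangle_picture (- e) a b c)"
    if "(i, j, u) \<in> picture_crossings (triangle_picture e a b c)" for e i j u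
    using that by (auto simp: picture_crossings_def picture_ends_def partner_strand_def length_triangle strand mark)
  show ?thesis
  proof (rule bij_betwI[where g = "\<lambda>(i, j, u). (i, j, - u)"])
    show "(\<lambda>(i, j, u). (i, j, - u)) \<in> picture_crossings (triangle_picture e a b c) \<rightarrow>
        picture_crossings (triangle_picture (- e) a b c)"
      using refl by auto
    show "(\<lambda>(i, j, u). (i, j, - u)) \<in> picture_crossings (triangle_picture (- e) a b c) \<rightarrow>
        picture_crossings (triangle_picture e a b c)"
      using refl[of _ _ _ "- e"] by auto
  qed auto
qed

section \<open>Invariance\<close>

lemma Phi_fr_R1_virtual:
  assumes "local_move D h Is strand_picture D' k virtual_curl_picture"
  shows "Phi_fr D' = Phi_fr D"
proof -
  interpret local_move D h Is strand_picture D' k virtual_curl_picture by fact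
  have none: "picture_crossings strand_picture = {}" "picture_crossings virtual_curl_picture = {}"
    by (simp_all add: picture_crossings_no_ends picture_ends_strand picture_ends_curl)
  show ?thesis by (rule Phi_fr_bijective_move[where f = id]) (simp_all add: none bij_betw_def)
qed

lemma Phi_fr_R2:
  assumes "local_move D h Is parallel_picture D' k (bigon_picture m)"
  shows "Phi_fr D' = Phi_fr D"
proof -
  interpret local_move D h Is parallel_picture D' k "bigon_picture m" by fact
  have none: "picture_crossings parallel_picture = {}"
    by (simp add: picture_crossings_no_ends picture_ends_parallel)
  have dir: "strand_dir Is 0 \<noteq> 0" "strand_dir Is 1 \<noteq> 0"
    using new.dir_bounds(1) by (simp_all add: length_bigon)
  consider (over) "m = Over" | (under) "m = Under" | (virtual) "\<not> classical m" by blast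
  then show ?thesis
  proof cases
    case over
    show ?thesis
      by (rule Phi_fr_cancelling_move[OF none picture_crossings_bigon(1)[folded over]])
         (simp, rule bigon_inner_index, use over dir in auto)
  next
    case under
    show ?thesis
      by (rule Phi_fr_cancelling_move[OF none picture_crossings_bigon(2)[folded under]])
         (simp, rule bigon_inner_index, use under dir in auto)
  next
    case virtual
    then have none': "picture_crossings (bigon_picture m) = {}"
      by (intro picture_crossings_no_ends) (simp add: picture_ends_bigon)
    show ?thesis by (rule Phi_fr_bijective_move[where f = id]) (simp_all add: none none' bij_betw_def)
  qed
qed

lemma Phi_fr_R3:
  assumes "local_move D h Is (triangle_picture (1/4) a b c) D' k (triangle_picture (-1/4) a b c)"
    and marks: "triangle_marks a b c"
  shows "Phi_fr D' = Phi_fr D"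
proof -
  interpret local_move D h Is "triangle_picture (1/4) a b c" D' k "triangle_picture (-1/4) a b c" by fact
  have dir: "strand_dir Is 0 \<noteq> 0" "strand_dir Is 1 \<noteq> 0" "strand_dir Is 2 \<noteq> 0"
    using old.dir_bounds(1) by (simp_all add: length_triangle)
  have minus: "(-1/4 :: real) = - (1/4)" by simp
  show ?thesis
    by (rule Phi_fr_bijective_move[where f = uminus])
       (unfold minus, rule triangle_reflection,
        rule triangle_inner_index[OF _ marks dir, unfolded minus])
qed

lemma Phi_fr_framed_reidemeister:
  assumes "framed_reidemeister T T'" "virtual_knot_diagram D" "virtual_knot_diagram D'"
    and shown: "shows_picture D h Is T" "shows_picture D' k Is T'"
    and same_disk: "h ` unit_square = k ` unit_square"
    and agree: "\<And>t. curve D t \<notin> h ` unit_square \<Longrightarrow> curve D' t = curve D t \<and> mark D' t = mark D t"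
  shows "Phi_fr D' = Phi_fr D"
proof -
  have move: "local_move D h Is T D' k T'"
    if tame: "tame_picture T" "tame_picture T'"
    and totals: "(\<And>i. i < length T \<Longrightarrow> strand_dir Is i \<noteq> 0) \<Longrightarrow>
      (\<And>g :: nat \<Rightarrow> int. (\<Sum>(i, v)\<in>picture_ends T'. picture_index Is T' i v * g i)
      = (\<Sum>(i, v)\<in>picture_ends T. picture_index Is T i v * g i))"
  proof -
    interpret old: shown_picture D h Is T by unfold_locales (fact assms(2) shown(1) tame(1))+
    interpret new: shown_picture D' k Is T' by unfold_locales (fact assms(3) shown(2) tame(2))+
    show ?thesis
      by unfold_locales (use same_disk agree totals old.dir_bounds(1) in auto)
  qed
  show ?thesis
    using assms(1)
  proof cases
    case R1_virtual
    show ?thesis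
      by (rule Phi_fr_R1_virtual, rule move[unfolded R1_virtual])
         (simp_all add: tame_strand tame_curl picture_ends_strand picture_ends_curl)
  next
    case (R2 m)
    have "local_move D h Is parallel_picture D' k (bigon_picture m)"
    proof (rule move[unfolded R2], rule tame_parallel, rule tame_bigon)
      fix g :: "nat \<Rightarrow> int"
      assume dir: "\<And>i. i < length parallel_picture \<Longrightarrow> strand_dir Is i \<noteq> 0"
      have nz: "strand_dir Is 0 \<noteq> 0" "strand_dir Is 1 \<noteq> 0"
        using dir[of 0] dir[of 1] by (simp_all add: parallel_picture_def)
      show "(\<Sum>(i, v)\<in>picture_ends (bigon_picture m). picture_index Is (bigon_picture m) i v * g i)
          = (\<Sum>(i, v)\<in>picture_ends parallel_picture. picture_index Is parallel_picture i v * g i)"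
        unfolding bigon_totals[OF nz] picture_ends_parallel by simp
    qed
    then show ?thesis by (rule Phi_fr_R2)
  next
    case (R3 a b c)
    have "local_move D h Is (triangle_picture (1/4) a b c) D' k (triangle_picture (-1/4) a b c)"
      by (rule move[unfolded R3(1,2)], rule tame_triangle, simp, rule tame_triangle, simp, rule triangle_totals)
    then show ?thesis using R3(3) by (rule Phi_fr_R3)
  qed
qed

lemma Phi_fr_framed_move:
  assumes "virtual_knot_diagram D" "virtual_knot_diagram D'" "framed_move D D'"
  shows "Phi_fr D = Phi_fr D'"
  using assms(3)
proof cases
  case (reparametrise f)
  then show ?thesis using Phi_fr_reparametrise assms(1,2) by simp
next
  case (isotopy H)
  then have "plane_diffeo (H 1)" by (simp add: plane_isotopy_def)
  then show ?thesis using Phi_fr_diffeo assms(1,2) isotopy by simp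
next
  case (reidemeister T T' h Is k)
  show ?thesis
    by (rule Phi_fr_framed_reidemeister[OF reidemeister(1) assms(1,2) reidemeister(2-4), symmetric])
       (rule reidemeister(5))
qed

lemma Phi_fr_framed_equiv:
  assumes "(D, D') \<in> framed_equiv"
  shows "Phi_fr D = Phi_fr D'"
proof -
  let ?R = "\<lambda>E E'. virtual_knot_diagram E \<and> virtual_knot_diagram E' \<and> framed_move E E'"
  have "equivclp ?R D D'" using assms by (simp add: framed_equiv_def)
  then show ?thesis
  proof (induction rule: equivclp_induct)
    case (step D\<^sub>1 D\<^sub>2)
    then show ?case using Phi_fr_framed_move[of D\<^sub>1 D\<^sub>2] Phi_fr_framed_move[of D\<^sub>2 D\<^sub>1] by auto
  qed simp
qed

lemma framed_equiv_refl: "virtual_knot_diagram D \<Longrightarrow> (D, D) \<in> framed_equiv"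
  by (simp add: framed_equiv_def)

theorem theorem5:
  shows "(\<forall>D D'. (D, D') \<in> framed_equiv \<longrightarrow> Phi_fr D = Phi_fr D') \<and>
    (\<exists>h \<in> hom (free_Abelian_group framed_virtual_knots) A_group.
       \<forall>D. virtual_knot_diagram D \<longrightarrow> h (frag_of (framed_equiv `` {D})) = Phi_fr D)"
proof
  show "\<forall>D D'. (D, D') \<in> framed_equiv \<longrightarrow> Phi_fr D = Phi_fr D'"
    using Phi_fr_framed_equiv by blast
  define \<Phi> where "\<Phi> K = Phi_fr (SOME D. D \<in> K)" for K
  have \<Phi>: "\<Phi> (framed_equiv `` {D}) = Phi_fr D" if "virtual_knot_diagram D" for D
  proof -
    have "D \<in> framed_equiv `` {D}" using framed_equiv_refl[OF that] by blast
    then have "(SOME E. E \<in> framed_equiv `` {D}) \<in> framed_equiv `` {D}" by (rule someI)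
    then show ?thesis unfolding \<Phi>_def using Phi_fr_framed_equiv by (metis Image_singleton_iff)
  qed
  have "\<Phi> ` framed_virtual_knots \<subseteq> carrier A_group"
    using \<Phi> knot_diagram.Phi_fr_closed
    by (auto simp: framed_virtual_knots_def quotient_def knot_diagram_def)
  then obtain h where h: "h \<in> hom (free_Abelian_group framed_virtual_knots) A_group"
    "\<And>K. K \<in> framed_virtual_knots \<Longrightarrow> h (frag_of K) = \<Phi> K"
    by (rule A.free_Abelian_group_universal) blast
  have "h (frag_of (framed_equiv `` {D})) = Phi_fr D" if "virtual_knot_diagram D" for D
  proof -
    have "framed_equiv `` {D} \<in> framed_virtual_knots"
      unfolding framed_virtual_knots_def using that by (simp add: quotientI)
    then show ?thesis using h(2) \<Phi>[OF that] by simp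
  qed
  then show "\<exists>h \<in> hom (free_Abelian_group framed_virtual_knots) A_group.
       \<forall>D. virtual_knot_diagram D \<longrightarrow> h (frag_of (framed_equiv `` {D})) = Phi_fr D"
    using h(1) by blast
qed

end
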